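(* The growth rate of $\mathrm{Av}(1324)$ is at most $27/2=13.5$.
   Context: $\mathrm{Av}_n(1324)$ is the set of permutations of length $n$ that have no subsequence order isomorphic to $1324$, and $\mathrm{Av}(1324)=\bigcup_n \mathrm{Av}_n(1324)$. The growth rate is $\mathrm{gr}(\mathrm{Av}(1324))=\lim_{n\to\infty}|\mathrm{Av}_n(1324)|^{1/n}$; this limit is known to exist and be finite (Marcus and Tardos). *)

theory Defs
  imports Complex_Main "HOL-Library.Sublist" "HOL-Combinatorics.Multiset_Permutations"
begin

text \<open>
  Permutations of length \<open>n\<close> are represented in one-line notation, as the lists in
  \<open>permutations_of_set {1..n}\<close>. The predicate \<open>subseq\<close> is the library's scattered
  (not necessarily contiguous) subsequence relation on lists.
\<close>

definition order_isomorphic :: "nat list \<Rightarrow> nat list \<Rightarrow> bool" where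
  "order_isomorphic xs ys \<longleftrightarrow>
     length xs = length ys \<and>
     (\<forall>i<length xs. \<forall>j<length xs. xs ! i < xs ! j \<longleftrightarrow> ys ! i < ys ! j)"

definition contains_pattern :: "nat list \<Rightarrow> nat list \<Rightarrow> bool" where
  "contains_pattern p s \<longleftrightarrow> (\<exists>xs. subseq xs p \<and> order_isomorphic xs s)"

definition Av_len :: "nat \<Rightarrow> nat list \<Rightarrow> nat list set" where
  "Av_len n s = {p \<in> permutations_of_set {1..n}. \<not> contains_pattern p s}"

definition Av :: "nat list \<Rightarrow> nat list set" where
  "Av s = (\<Union>n. Av_len n s)"

text \<open>
  The value of \<open>lim\<close> is meaningful only for a convergent sequence. For principal classes
  \<open>Av s\<close> with \<open>s\<close> a nonempty permutation, convergence is the theorem of Marcus and Tardos.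
\<close>

definition growth_rate :: "nat list set \<Rightarrow> real" where
  "growth_rate C = lim (\<lambda>n. root n (real (card {p \<in> C. length p = n})))"

lemma Av_length_slice: "{p \<in> Av s. length p = n} = Av_len n s"
  by (auto simp: Av_def Av_len_def length_finite_permutations_of_set)

lemma finite_Av_len: "finite (Av_len n s)"
  by (simp add: Av_len_def)

end

theory Submission
  imports Defs "HOL-Computational_Algebra.Formal_Power_Series"
begin

text \<open>
  A permutation that avoids 1324 is cut greedily into consecutive columns, from left to right. In the
  current column a threshold separates the tops, which avoid 213, from the bottoms, which avoid 132.
  The threshold is as low and the column as long as these two conditions allow. If a point right of
  the column were above its threshold, or a point of the column below the next threshold, it would
  complete a 132 or a 213 to a 1324. So the rows interlock like a descending staircase: each row
  consists of the bottoms of one column and the tops of the next one. Hence the permutation is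
  determined by its set of top values, which has at most \<open>2 ^ n\<close> possibilities, and by the order types of
  its columns (\<open>ex_staircase\<close>, \<open>staircase_unique\<close>).

  A column together with its threshold is a domino, as studied by Bevan, Brignall, Elvey Price and
  Pennington. Removing the last point of a domino decomposes it: a last bottom can sit at any of the
  skew cuts of the bottoms; a last top with \<open>m\<close> smaller tops splits the domino at these \<open>m\<close> points into
  \<open>m + 1\<close> independent dominoes. With \<open>z\<close> marking points and \<open>u\<close> marking the skew components of the bottoms
  this yields the functional equation
  \<open>F(u) = 1 + z u F(u) + z u (F(u) - F(1)) / (u - 1) + z F(u) / (1 - z F(u))\<close>
  for the generating function \<open>F(u) = F(z, u)\<close> of dominoes (\<open>domino_encodes\<close>, \<open>encodes_unique\<close>).

  The equation is used at the critical point \<open>z = 4/27\<close> only. In the variable \<open>v = u - 1\<close> its right-hand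
  side is monotone for the coefficientwise order, so any solution with nonnegative coefficients
  dominates all truncations of \<open>F\<close> (\<open>sum_wt_le\<close>). Such a solution is written down explicitly; it is
  algebraic, and its value at \<open>v = 0\<close> is \<open>27/16\<close>. So the nonempty dominoes have total weight at most
  \<open>11/16\<close>, which is less than 1, and therefore the sequences of nonempty dominoes with \<open>n\<close> points number
  at most \<open>(27/4) ^ n\<close> (\<open>code_seqs_bound\<close>). Together this bounds the number of avoiders of length \<open>n\<close> by
  \<open>2 ^ n * (27/4) ^ n = (27/2) ^ n\<close> (\<open>card_avoiders_le\<close>).

  Skew sums of avoiders are avoiders, so these numbers are supermultiplicative and Fekete's lemma
  shows that the limit that defines the growth rate exists; the bound passes to it.
\<close>
section \<open>Avoidance and dominoes\<close>

lemma distinct_subseq: "distinct ys \<Longrightarrow> subseq xs ys \<Longrightarrow> distinct xs"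
  by (auto simp: subseq_conv_nths)

lemma subseq_set: "subseq xs ys \<Longrightarrow> set xs \<subseteq> set ys"
  by (auto simp: subseq_conv_nths dest: in_set_nthsD)

lemma subseq_snoc: "subseq xs ys \<Longrightarrow> subseq (xs @ [v]) (ys @ [v])"
  by simp

lemma subseq_snocD:
  assumes "subseq xs (ys @ [v])"
  shows "subseq xs ys \<or> (\<exists>xs'. xs = xs' @ [v] \<and> subseq xs' ys)"
proof -
  obtain as bs where *: "xs = as @ bs" "subseq as ys" "subseq bs [v]"
    using assms by (rule subseq_appendE)
  then have "bs = [] \<or> bs = [v]"
    by (cases bs) (auto split: if_splits)
  then show ?thesis using * by auto
qed

lemma subseq_pairI: "a \<in> set xs \<Longrightarrow> b \<in> set ys \<Longrightarrow> subseq [a, b] (xs @ ys)"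
  using list_emb_append_mono[of "(=)" "[a]" xs "[b]" ys] by (simp add: subseq_singleton_left)

definition av1324 :: "nat list \<Rightarrow> bool" where
  "av1324 xs \<longleftrightarrow> \<not> (\<exists>a b c d. subseq [a, b, c, d] xs \<and> a < c \<and> c < b \<and> b < d)"

definition av213 :: "nat list \<Rightarrow> bool" where
  "av213 xs \<longleftrightarrow> \<not> (\<exists>a b c. subseq [a, b, c] xs \<and> b < a \<and> a < c)"

definition av132 :: "nat list \<Rightarrow> bool" where
  "av132 xs \<longleftrightarrow> \<not> (\<exists>a b c. subseq [a, b, c] xs \<and> a < c \<and> c < b)"

lemma av1324_subseq: "av1324 ys \<Longrightarrow> subseq xs ys \<Longrightarrow> av1324 xs"
  unfolding av1324_def by (meson subseq_order.trans)

lemma av213_subseq: "av213 ys \<Longrightarrow> subseq xs ys \<Longrightarrow> av213 xs"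
  unfolding av213_def by (meson subseq_order.trans)

lemma av132_subseq: "av132 ys \<Longrightarrow> subseq xs ys \<Longrightarrow> av132 xs"
  unfolding av132_def by (meson subseq_order.trans)

abbreviation tops :: "nat \<Rightarrow> nat list \<Rightarrow> nat list" where
  "tops y xs \<equiv> filter (\<lambda>x. y \<le> x) xs"

abbreviation bots :: "nat \<Rightarrow> nat list \<Rightarrow> nat list" where
  "bots y xs \<equiv> filter (\<lambda>x. x < y) xs"

definition domino :: "nat \<Rightarrow> nat list \<Rightarrow> bool" where
  "domino y xs \<longleftrightarrow> distinct xs \<and> av1324 xs \<and> av213 (tops y xs) \<and> av132 (bots y xs)"

lemma domino_subseq:
  assumes "domino y ys" "subseq xs ys"
  shows "domino y xs"
  using assms av1324_subseq av213_subseq av132_subseq subseq_filter distinct_subseq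
  unfolding domino_def by metis

section \<open>Encoding dominoes\<close>

text \<open>
  A code records how a domino is built by appending its last point. \<open>AddBot c r\<close> appends a bottom that
  lies below the first \<open>r\<close> skew components of the bottoms and above the others, with which it merges
  into one component. \<open>AddTop c\<close> appends a top that is smaller than all earlier tops. \<open>AddTopAbove c d\<close>
  concatenates the dominoes of \<open>c\<close> and \<open>d\<close> with a new lowest top between them. Since \<open>d\<close> ends with a top,
  this amounts to the last top of \<open>d\<close> having one more smaller top; iterating it reaches any number of
  smaller tops with a constructor of bounded arity.
\<close>

datatype dcode = Empty | AddBot dcode nat | AddTop dcode | AddTopAbove dcode dcode

primrec points :: "dcode \<Rightarrow> nat" where
  "points Empty = 0"
| "points (AddBot c r) = Suc (points c)"
| "points (AddTop c) = Suc (points c)"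
| "points (AddTopAbove c d) = Suc (points c + points d)"

primrec comps :: "dcode \<Rightarrow> nat" where
  "comps Empty = 0"
| "comps (AddBot c r) = Suc r"
| "comps (AddTop c) = comps c"
| "comps (AddTopAbove c d) = comps c + comps d"

primrec ends_top :: "dcode \<Rightarrow> bool" where
  "ends_top Empty = False"
| "ends_top (AddBot c r) = False"
| "ends_top (AddTop c) = True"
| "ends_top (AddTopAbove c d) = True"

primrec valid :: "dcode \<Rightarrow> bool" where
  "valid Empty = True"
| "valid (AddBot c r) = (valid c \<and> r \<le> comps c)"
| "valid (AddTop c) = valid c"
| "valid (AddTopAbove c d) = (valid c \<and> valid d \<and> ends_top d)"

text \<open>
  The last argument is the list of the skew components of the bottoms, in order of position, so that
  earlier blocks have larger values. Each of its lists is one component.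
\<close>

inductive encodes :: "nat \<Rightarrow> nat list \<Rightarrow> dcode \<Rightarrow> nat list list \<Rightarrow> bool" for y where
  Empty: "encodes y [] Empty []"
| AddBot: "encodes y xs c bs \<Longrightarrow> v < y \<Longrightarrow> r \<le> length bs \<Longrightarrow>
    \<forall>x\<in>set (concat (take r bs)). v < x \<Longrightarrow> \<forall>x\<in>set (concat (drop r bs)). x < v \<Longrightarrow>
    encodes y (xs @ [v]) (AddBot c r) (take r bs @ [concat (drop r bs) @ [v]])"
| AddTop: "encodes y xs c bs \<Longrightarrow> y \<le> v \<Longrightarrow> \<forall>x\<in>set xs. y \<le> x \<longrightarrow> v < x \<Longrightarrow>
    encodes y (xs @ [v]) (AddTop c) bs"
| AddTopAbove: "encodes y ps c bs \<Longrightarrow> encodes y rs d cs \<Longrightarrow> ends_top d \<Longrightarrow> y \<le> k \<Longrightarrow>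
    \<forall>x\<in>set ps \<union> set rs. y \<le> x \<longrightarrow> k < x \<Longrightarrow>
    \<forall>x\<in>set ps. \<forall>z\<in>set rs. (y \<le> x \<longleftrightarrow> y \<le> z) \<longrightarrow> z < x \<Longrightarrow>
    encodes y (ps @ k # rs) (AddTopAbove c d) (bs @ cs)"

lemma concat_take_drop: "concat (take r bs) @ concat (drop r bs) = concat bs"
  by (metis append_take_drop_id concat_append)

lemma encodes_props:
  "encodes y xs c bs \<Longrightarrow> valid c \<and> points c = length xs \<and> comps c = length bs \<and> concat bs = bots y xs"
  by (induction rule: encodes.induct) (auto simp: concat_take_drop simp flip: append_assoc)

text \<open>
  Two dominoes have the same shape if they are order isomorphic and their tops are at the same
  positions. Stating this on the zipped lists makes it compatible with appending.
\<close>

definition similar :: "nat \<Rightarrow> nat list \<Rightarrow> nat \<Rightarrow> nat list \<Rightarrow> bool" where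
  "similar y xs y' ys \<longleftrightarrow> length xs = length ys \<and>
     (\<forall>(a, b)\<in>set (zip xs ys). (y \<le> a \<longleftrightarrow> y' \<le> b) \<and>
        (\<forall>(a', b')\<in>set (zip xs ys). a < a' \<longleftrightarrow> b < b'))"

lemma zip_filter:
  assumes "length xs = length ys" "\<forall>(a, b)\<in>set (zip xs ys). P a \<longleftrightarrow> R b"
  shows "zip (filter P xs) (filter R ys) = filter (\<lambda>(a, b). P a) (zip xs ys)
    \<and> length (filter P xs) = length (filter R ys)"
  using assms by (induction xs ys rule: list_induct2) auto

lemma length_concat_eq: "map length xs = map length ys \<Longrightarrow> length (concat xs) = length (concat ys)"
  by (simp add: length_concat)

text \<open>
  The code determines the shape. The lengths of the blocks are carried along in the induction because
  \<open>AddBot\<close> refers to the position of its cut only through the number of blocks before it.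
\<close>

lemma encodes_unique:
  assumes "encodes y xs c bs" "encodes y' ys c bs'"
  shows "similar y xs y' ys \<and> map length bs = map length bs'"
  using assms
proof (induction arbitrary: ys bs' rule: encodes.induct)
  case Empty
  then show ?case
    by (auto elim: encodes.cases simp: similar_def)
next
  case (AddBot xs c bs v r)
  from AddBot.prems obtain xs' cs v' where *: "ys = xs' @ [v']" "bs' = take r cs @ [concat (drop r cs) @ [v']]"
    "encodes y' xs' c cs" "v' < y'" "\<forall>x\<in>set (concat (take r cs)). v' < x" "\<forall>x\<in>set (concat (drop r cs)). x < v'"
    by (auto elim: encodes.cases)
  have sim: "similar y xs y' xs'" and len: "map length bs = map length cs"
    using AddBot.IH *(3) by auto
  have lens: "map length (take r bs) = map length (take r cs)" "map length (drop r bs) = map length (drop r cs)"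
    using len by (metis take_map, metis drop_map)
  have len_xs: "length xs = length xs'"
    using sim by (simp add: similar_def)
  have zip_bs: "zip (bots y xs) (bots y' xs') = filter (\<lambda>(a, b). a < y) (zip xs xs')"
    using sim by (intro conjunct1[OF zip_filter]) (auto simp: similar_def not_le[symmetric])
  have "(a < v \<longleftrightarrow> b < v') \<and> (v < a \<longleftrightarrow> v' < b)" if ab: "(a, b) \<in> set (zip xs xs')" for a b
  proof (cases "a < y")
    case True
    have "(a, b) \<in> set (zip (concat bs) (concat cs))"
      using True ab zip_bs encodes_props[OF AddBot.hyps(1)] encodes_props[OF *(3)] by auto
    also have "zip (concat bs) (concat cs) =
        zip (concat (take r bs)) (concat (take r cs)) @ zip (concat (drop r bs)) (concat (drop r cs))"
      using length_concat_eq[OF lens(1)] by (metis concat_take_drop zip_append)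
    finally have "a \<in> set (concat (take r bs)) \<and> b \<in> set (concat (take r cs))
      \<or> a \<in> set (concat (drop r bs)) \<and> b \<in> set (concat (drop r cs))"
      by (auto dest: set_zip_leftD set_zip_rightD simp del: set_concat)
    then show ?thesis
      using *(5,6) AddBot.hyps(4,5) by (meson less_asym)
  next
    case False
    then have "y' \<le> b" using sim ab by (auto simp: similar_def)
    then show ?thesis using False AddBot.hyps *(4) by simp
  qed
  then have "similar y (xs @ [v]) y' (xs' @ [v'])"
    using sim len_xs AddBot.hyps *(4) by (auto simp: similar_def)
  then show ?case
    using lens *(1,2) by (auto simp: length_concat)
next
  case (AddTop xs c bs v)
  from AddTop.prems obtain xs' v' where *: "ys = xs' @ [v']"
    "encodes y' xs' c bs'" "y' \<le> v'" "\<forall>x\<in>set xs'. y' \<le> x \<longrightarrow> v' < x"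
    by (auto elim: encodes.cases)
  have sim: "similar y xs y' xs'" and len: "map length bs = map length bs'"
    using AddTop.IH *(2) by auto
  have "(a < v \<longleftrightarrow> b < v') \<and> (v < a \<longleftrightarrow> v' < b)" if ab: "(a, b) \<in> set (zip xs xs')" for a b
  proof (cases "a < y")
    case True
    then have "b < y'" using sim ab by (auto simp: similar_def)
    then show ?thesis using True AddTop.hyps *(3) by simp
  next
    case False
    then have "y' \<le> b" using sim ab by (auto simp: similar_def)
    then show ?thesis
      using False AddTop.hyps *(4) ab by (meson in_set_zipE less_asym not_le)
  qed
  then show ?case
    using sim len AddTop.hyps * by (auto simp: similar_def)
next
  case (AddTopAbove ps c bs rs d cs k)
  from AddTopAbove.prems obtain ps' k' rs' bs'' cs' where *: "ys = ps' @ k' # rs'" "bs' = bs'' @ cs'"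
    "encodes y' ps' c bs''" "encodes y' rs' d cs'" "y' \<le> k'"
    "\<forall>x\<in>set ps' \<union> set rs'. y' \<le> x \<longrightarrow> k' < x"
    "\<forall>x\<in>set ps'. \<forall>z\<in>set rs'. (y' \<le> x \<longleftrightarrow> y' \<le> z) \<longrightarrow> z < x"
    by (auto elim: encodes.cases)
  have sim: "similar y ps y' ps'" "similar y rs y' rs'"
    and len: "map length bs = map length bs''" "map length cs = map length cs'"
    using AddTopAbove.IH *(3,4) by auto
  have k: "(a < k \<longleftrightarrow> b < k') \<and> (k < a \<longleftrightarrow> k' < b)" if ab: "(a, b) \<in> set (zip ps ps') \<union> set (zip rs rs')" for a b
  proof -
    have tag: "y \<le> a \<longleftrightarrow> y' \<le> b"
      using sim ab by (auto simp: similar_def)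
    have "a \<in> set ps \<union> set rs" "b \<in> set ps' \<union> set rs'"
      using ab by (auto dest: set_zip_leftD set_zip_rightD)
    then show ?thesis
      using tag AddTopAbove.hyps(4,5) *(5,6) by (meson less_asym not_le less_le_trans)
  qed
  \<comment> \<open>A top of one part and a bottom of the other are compared by the thresholds, points of the same
      kind by the rule for \<open>AddTopAbove\<close>.\<close>
  have pr: "(a < a' \<longleftrightarrow> b < b') \<and> (a' < a \<longleftrightarrow> b' < b)"
    if ab: "(a, b) \<in> set (zip ps ps')" and ab': "(a', b') \<in> set (zip rs rs')" for a b a' b'
  proof -
    have tag: "y \<le> a \<longleftrightarrow> y' \<le> b" "y \<le> a' \<longleftrightarrow> y' \<le> b'"
      using sim ab ab' by (auto simp: similar_def)
    have mem: "a \<in> set ps" "b \<in> set ps'" "a' \<in> set rs" "b' \<in> set rs'"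
      using ab ab' by (auto dest: set_zip_leftD set_zip_rightD)
    show ?thesis
    proof (cases "y \<le> a \<longleftrightarrow> y \<le> a'")
      case True
      then have "a' < a" "b' < b"
        using mem tag AddTopAbove.hyps(6) *(7) by blast+
      then show ?thesis by simp
    next
      case False
      then show ?thesis using tag by auto
    qed
  qed
  have tag: "(y \<le> a \<longleftrightarrow> y' \<le> b)" if "(a, b) \<in> set (zip ps ps') \<union> set (zip rs rs')" for a b
    using that sim by (auto simp: similar_def)
  have inner: "a < a' \<longleftrightarrow> b < b'"
    if "(a, b) \<in> set (zip ps ps') \<and> (a', b') \<in> set (zip ps ps') \<or> (a, b) \<in> set (zip rs rs') \<and> (a', b') \<in> set (zip rs rs')" for a b a' b'
    using that sim by (auto simp: similar_def)
  have len': "length ps = length ps'" "length rs = length rs'"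
    using sim by (auto simp: similar_def)
  have Z: "set (zip (ps @ k # rs) (ps' @ k' # rs')) = set (zip ps ps') \<union> {(k, k')} \<union> set (zip rs rs')"
    using len' by auto
  have "similar y (ps @ k # rs) y' (ps' @ k' # rs')"
    unfolding similar_def Z
    using len' tag inner pr k AddTopAbove.hyps(4) *(5) by simp blast
  then show ?case
    using len * by simp
qed

text \<open>
  A cut of the bottoms is a place where all values before exceed all values after. A further bottom
  that creates no 132 must go to a cut, so the index stored by \<open>AddBot\<close> suffices if every cut
  falls between two blocks.
\<close>

definition covers_cuts :: "nat list list \<Rightarrow> bool" where
  "covers_cuts bs \<longleftrightarrow> (\<forall>hi lo. concat bs = hi @ lo \<longrightarrow> (\<forall>x\<in>set hi. \<forall>z\<in>set lo. z < x)
     \<longrightarrow> (\<exists>r\<le>length bs. hi = concat (take r bs)))"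

lemma covers_cuts_append:
  assumes "covers_cuts bs" "covers_cuts cs"
  shows "covers_cuts (bs @ cs)"
  unfolding covers_cuts_def
proof (intro allI impI)
  fix hi lo
  assume eq: "concat (bs @ cs) = hi @ lo" and gt: "\<forall>x\<in>set hi. \<forall>z\<in>set lo. z < x"
  then obtain us where "concat bs = hi @ us \<and> lo = us @ concat cs \<or> hi = concat bs @ us \<and> concat cs = us @ lo"
    by (auto simp: append_eq_append_conv2)
  then show "\<exists>r\<le>length (bs @ cs). hi = concat (take r (bs @ cs))"
  proof
    assume *: "concat bs = hi @ us \<and> lo = us @ concat cs"
    then obtain r where "r \<le> length bs" "hi = concat (take r bs)"
      using assms(1) gt unfolding covers_cuts_def by (metis UnCI set_append)
    then show ?thesis by (intro exI[of _ r]) simp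
  next
    assume *: "hi = concat bs @ us \<and> concat cs = us @ lo"
    then obtain r where "r \<le> length cs" "us = concat (take r cs)"
      using assms(2) gt unfolding covers_cuts_def by (metis UnCI set_append)
    then show ?thesis using * by (intro exI[of _ "length bs + r"]) simp
  qed
qed

text \<open>
  After appending \<open>v\<close> the cuts inside the merged part disappear, because \<open>v\<close> exceeds the values before
  such a cut and comes after it. The cuts up to the insertion place and the trivial one at
  the end remain.
\<close>

lemma covers_cuts_merge:
  assumes "covers_cuts bs" "r \<le> length bs"
    and hi: "\<forall>x\<in>set (concat (take r bs)). v < x" and lo: "\<forall>x\<in>set (concat (drop r bs)). x < v"
  shows "covers_cuts (take r bs @ [concat (drop r bs) @ [v]])"
  unfolding covers_cuts_def
proof (intro allI impI)
  let ?bs = "take r bs @ [concat (drop r bs) @ [v]]"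
  fix hi' lo'
  assume eq: "concat ?bs = hi' @ lo'" and gt: "\<forall>x\<in>set hi'. \<forall>z\<in>set lo'. z < x"
  have cat: "concat ?bs = concat bs @ [v]"
    by (simp add: concat_take_drop flip: append_assoc)
  show "\<exists>r'\<le>length ?bs. hi' = concat (take r' ?bs)"
  proof (cases lo' rule: rev_cases)
    case Nil
    then have "hi' = concat (take (length ?bs) ?bs)"
      using eq by (simp only: append_Nil2 take_all order_refl)
    then show ?thesis by blast
  next
    case (snoc lo'' v')
    then have v: "v' = v" and bs: "concat bs = hi' @ lo''"
      using eq cat by (simp_all flip: append_assoc)
    have "\<exists>r'\<le>length bs. hi' = concat (take r' bs)"
      using assms(1) bs gt snoc unfolding covers_cuts_def by simp
    then obtain r' where r': "r' \<le> length bs" "hi' = concat (take r' bs)"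
      by blast
    show ?thesis
    proof (cases "r' \<le> r")
      case True
      then show ?thesis using r' assms(2) by (intro exI[of _ r']) (simp add: min_def)
    next
      case False
      have "take r' bs = take r bs @ take (r' - r) (drop r bs)"
        using False by (metis le_add_diff_inverse nat_le_linear take_add)
      then have hi'_eq: "hi' = concat (take r bs) @ concat (take (r' - r) (drop r bs))"
        using r' by simp
      \<comment> \<open>A cut beyond the insertion place can only be that place itself, all blocks between being empty:
          a value between the two would have to be both below and above \<open>v\<close>.\<close>
      have "x < v \<and> v < x" if "x \<in> set (concat (take (r' - r) (drop r bs)))" for x
      proof
        have "set (take (r' - r) (drop r bs)) \<subseteq> set (drop r bs)"
          by (rule set_take_subset)
        then show "x < v" using lo that by auto
        have "x \<in> set hi'" using that hi'_eq by simp
        then show "v < x" using gt snoc v by simp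
      qed
      then have "set (concat (take (r' - r) (drop r bs))) = {}"
        by (metis all_not_in_conv less_asym)
      then have "hi' = concat (take r bs)"
        using hi'_eq by (simp only: set_empty append_Nil2)
      then show ?thesis using assms(2) by (intro exI[of _ r]) simp
    qed
  qed
qed

text \<open>
  Every domino has a code, by removal of its last point \<open>v\<close>. If \<open>v\<close> is a bottom, avoiding 132 forces
  the larger bottoms to precede the smaller ones. If \<open>v\<close> is a top and \<open>k\<close> is the first smaller top,
  the domino splits at \<open>k\<close>. A top after \<open>k\<close> exceeds \<open>k\<close>, since otherwise it would form a 213 with \<open>k\<close> and
  \<open>v\<close>. The two parts are skew to each other among the tops, since an ascent across \<open>k\<close> gives a 213, and
  among the bottoms, since such an ascent together with \<open>k\<close> and \<open>v\<close> gives a 1324.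
\<close>

lemma domino_encodes:
  assumes "domino y xs"
  shows "\<exists>c bs. encodes y xs c bs \<and> covers_cuts bs \<and> (ends_top c \<longleftrightarrow> xs \<noteq> [] \<and> y \<le> last xs)"
  using assms
proof (induction xs rule: length_induct)
  case (1 xs)
  show ?case
  proof (cases xs rule: rev_cases)
    case Nil
    then show ?thesis
      by (intro exI[of _ Empty] exI[of _ "[]"]) (auto intro: encodes.Empty simp: covers_cuts_def)
  next
    case (snoc xs' v)
    have dom': "domino y xs'"
      using 1(2) snoc by (auto intro: domino_subseq)
    have dist: "distinct xs'" "v \<notin> set xs'"
      using 1(2) snoc by (auto simp: domino_def)
    obtain c bs where c: "encodes y xs' c bs" "covers_cuts bs"
      using 1(1) dom' snoc by (metis length_append_singleton lessI)
    have bs: "concat bs = bots y xs'"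
      using encodes_props[OF c(1)] by simp
    show ?thesis
    proof (cases "v < y")
      case True
      let ?hi = "takeWhile (\<lambda>x. v < x) (concat bs)" and ?lo = "dropWhile (\<lambda>x. v < x) (concat bs)"
      have split: "concat bs = ?hi @ ?lo" by simp
      have lo: "x < v" if x: "x \<in> set ?lo" for x
      proof (rule ccontr)
        assume "\<not> x < v"
        moreover have "x \<in> set xs'"
          using x bs by (metis filter_is_subset set_dropWhileD subsetD)
        ultimately have "v < x"
          using dist by (metis linorder_neqE_nat)
        obtain a as where a: "?lo = a # as"
          using x by (cases ?lo) auto
        have "\<not> v < a" using a by (metis hd_dropWhile list.distinct(1) list.sel(1))
        moreover have "a \<in> set xs'"
          using a bs by (metis filter_is_subset list.set_intros(1) set_dropWhileD subsetD)
        ultimately have "a < v"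
          using dist by (metis linorder_neqE_nat)
        have "x \<in> set as" using x a \<open>v < x\<close> \<open>a < v\<close> by auto
        then have "subseq [a, x] ?lo"
          using a by (simp add: subseq_singleton_left)
        then have "subseq ([a, x] @ [v]) (bots y xs' @ [v])"
          using split bs by (metis subseq_drop_many subseq_snoc)
        then have "\<not> av132 (bots y xs)"
          using \<open>a < v\<close> \<open>v < x\<close> snoc True unfolding av132_def by auto
        then show False using 1(2) by (simp add: domino_def)
      qed
      have hi: "v < x" if "x \<in> set ?hi" for x
        using that by (rule set_takeWhileD[THEN conjunct2])
      obtain r where r: "r \<le> length bs" "?hi = concat (take r bs)"
        using c(2) split hi lo unfolding covers_cuts_def by (meson less_trans)
      have lo_eq: "?lo = concat (drop r bs)"
        using split r concat_take_drop by (metis same_append_eq)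
      have "encodes y (xs' @ [v]) (AddBot c r) (take r bs @ [concat (drop r bs) @ [v]])"
        using c True r hi lo lo_eq by (intro encodes.AddBot) (auto simp del: set_concat)
      moreover have "covers_cuts (take r bs @ [concat (drop r bs) @ [v]])"
        using c r hi lo lo_eq by (intro covers_cuts_merge) (auto simp del: set_concat)
      ultimately show ?thesis
        using snoc True by (intro exI[of _ "AddBot c r"]) auto
    next
      case False
      then have v: "y \<le> v" by simp
      show ?thesis
      proof (cases "\<forall>x\<in>set xs'. y \<le> x \<longrightarrow> v < x")
        case True
        then have "encodes y (xs' @ [v]) (AddTop c) bs"
          using c v by (intro encodes.AddTop) auto
        then show ?thesis using c v snoc by (intro exI[of _ "AddTop c"] exI[of _ bs]) auto
      next
        case False
        then have "\<exists>x\<in>set xs'. y \<le> x \<and> x < v"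
          using dist by (metis linorder_neqE_nat)
        then obtain ps k rs where k: "xs' = ps @ k # rs" "y \<le> k \<and> k < v"
          and ps: "\<forall>x\<in>set ps. \<not> (y \<le> x \<and> x < v)"
          by (elim split_list_first_propE) auto
        let ?rs = "rs @ [v]"
        have xs: "xs = ps @ k # ?rs" using snoc k by simp
        have av: "av1324 xs" "av213 (tops y xs)"
          using 1(2) by (auto simp: domino_def)
        have ps_gt: "v < x" if "x \<in> set ps" "y \<le> x" for x
          using ps that dist k by (metis in_set_conv_decomp linorder_neqE_nat append_assoc append_Cons)
        have tops_xs: "tops y xs = tops y ps @ k # tops y rs @ [v]"
          using xs k v by simp
        have rs_gt: "k < z" if z: "z \<in> set rs" "y \<le> z" for z
        proof (rule ccontr)
          assume "\<not> k < z"
          then have "z < k" using dist k z by (auto simp: not_less le_less)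
          have "subseq [k, z, v] (tops y xs)"
            unfolding tops_xs using z
            by (intro subseq_drop_many) (simp add: subseq_singleton_left subseq_pairI)
          then show False
            using av(2) \<open>z < k\<close> k(2) unfolding av213_def by blast
        qed
        have "domino y ps" "domino y ?rs"
          using 1(2) xs by (auto intro: domino_subseq)
        have lens: "length ps < length xs" "length ?rs < length xs"
          using xs by auto
        obtain c1 bs1 where c1: "encodes y ps c1 bs1" "covers_cuts bs1"
          using 1(1) lens(1) \<open>domino y ps\<close> by blast
        obtain c2 bs2 where c2: "encodes y ?rs c2 bs2" "covers_cuts bs2" "ends_top c2 \<longleftrightarrow> ?rs \<noteq> [] \<and> y \<le> last ?rs"
          using 1(1) lens(2) \<open>domino y ?rs\<close> by blast
        then have "ends_top c2" using v by simp
        have sep: "z < x" if x: "x \<in> set ps" and z: "z \<in> set ?rs" and tag: "y \<le> x \<longleftrightarrow> y \<le> z" for x z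
        proof (rule ccontr)
          assume "\<not> z < x"
          moreover have "x \<noteq> z" using x z 1(2) xs by (auto simp: domino_def)
          ultimately have "x < z" by simp
          show False
          proof (cases "y \<le> x")
            case True
            have "v < x" using ps_gt x True by simp
            have "subseq ([x] @ [k, z]) (tops y ps @ k # tops y ?rs)"
              using x z True tag v by (intro list_emb_append_mono) (auto simp: subseq_singleton_left)
            then have "subseq [x, k, z] (tops y xs)"
              using xs k by simp
            moreover have "k < x" using \<open>v < x\<close> k by simp
            ultimately show False
              using av(2) \<open>x < z\<close> unfolding av213_def by blast
          next
            case False
            then have "z \<in> set rs" using z tag v by auto
            then have "subseq ([x] @ k # [z, v]) (ps @ k # ?rs)"
              using x by (intro list_emb_append_mono) (simp_all add: subseq_singleton_left subseq_pairI)
            then have "subseq [x, k, z, v] xs" using xs by simp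
            moreover have "z < k" using False tag k by simp
            ultimately show False
              using av(1) \<open>x < z\<close> k(2) unfolding av1324_def by blast
          qed
        qed
        have "encodes y (ps @ k # ?rs) (AddTopAbove c1 c2) (bs1 @ bs2)"
        proof (rule encodes.AddTopAbove[OF c1(1) c2(1) \<open>ends_top c2\<close>])
          show "\<forall>x\<in>set ps \<union> set ?rs. y \<le> x \<longrightarrow> k < x"
            using ps_gt rs_gt k by fastforce
        qed (use sep k in auto)
        then show ?thesis
          using covers_cuts_append[OF c1(2) c2(2)] xs v
          by (intro exI[of _ "AddTopAbove c1 c2"] exI[of _ "bs1 @ bs2"]) auto
      qed
    qed
  qed
qed

section \<open>The greedy staircase\<close>

definition code_seqs :: "nat \<Rightarrow> dcode list set" where
  "code_seqs n = {cs. (\<forall>c\<in>set cs. valid c \<and> c \<noteq> Empty) \<and> sum_list (map points cs) = n}"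

text \<open>
  The set \<open>U\<close> collects the top values of all columns and the list holds the codes of the columns. The two
  side conditions on the remaining columns are what decoding needs: the tops of the first column are the
  largest values of all, and its bottoms are the largest values outside \<open>U\<close>.
\<close>

inductive staircase :: "nat list \<Rightarrow> nat set \<Rightarrow> dcode list \<Rightarrow> bool" where
  Nil: "staircase [] {} []"
| Cons: "encodes y s c bs \<Longrightarrow> s \<noteq> [] \<Longrightarrow> staircase xs U cs \<Longrightarrow> \<forall>z\<in>set xs. z < y \<Longrightarrow>
    \<forall>x\<in>set s. x < y \<longrightarrow> (\<forall>z\<in>set xs - U. z < x) \<Longrightarrow>
    staircase (s @ xs) ({x \<in> set s. y \<le> x} \<union> U) (c # cs)"

lemma staircase_props:
  "staircase xs U cs \<Longrightarrow> U \<subseteq> set xs \<and> cs \<in> code_seqs (length xs)"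
proof (induction rule: staircase.induct)
  case (Cons y s c bs xs U cs)
  have "valid c \<and> points c = length s"
    using encodes_props[OF Cons.hyps(1)] by simp
  moreover from this have "c \<noteq> Empty" using Cons.hyps(2) by auto
  ultimately show ?case using Cons.IH by (auto simp: code_seqs_def)
qed (simp add: code_seqs_def)

definition threshold :: "nat list \<Rightarrow> nat" where
  "threshold xs = (LEAST y. av213 (tops y xs))"

lemma av213_threshold: "av213 (tops (threshold xs) xs)"
proof -
  have "tops (Suc (Max (set xs))) xs = []"
    by (auto simp: filter_empty_conv not_le less_Suc_eq_le)
  then have "av213 (tops (Suc (Max (set xs))) xs)"
    by (simp only:) (simp add: av213_def)
  then show ?thesis
    unfolding threshold_def by (rule LeastI)
qed

text \<open>
  By minimality of the threshold, the value just below it plays the part of the 1 in a 213 of \<open>xs\<close>; a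
  point in front of \<open>xs\<close> that is smaller still extends this 213 to a 1324.
\<close>

lemma threshold_le:
  assumes "av1324 (x # xs)" "x \<notin> set xs"
  shows "threshold xs \<le> x"
proof (rule ccontr)
  assume "\<not> threshold xs \<le> x"
  then obtain t where t: "threshold xs = Suc t" "x \<le> t"
    by (cases "threshold xs") auto
  have "\<not> av213 (tops t xs)"
    using not_less_Least[of t "\<lambda>y. av213 (tops y xs)"] t by (simp add: threshold_def)
  then obtain b a c where bac: "subseq [b, a, c] (tops t xs)" "a < b" "b < c"
    unfolding av213_def by auto
  have sub: "subseq [b, a, c] xs"
    using bac(1) subseq_filter_left subseq_order.trans by blast
  have "set [b, a, c] \<subseteq> set (tops t xs)"
    using bac(1) by (rule subseq_set)
  then have mem: "t \<le> a" "a \<in> set xs" by auto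
  have "a = t"
  proof (rule ccontr)
    assume "a \<noteq> t"
    then have "filter (\<lambda>x. Suc t \<le> x) [b, a, c] = [b, a, c]"
      using mem bac by auto
    then have "subseq [b, a, c] (tops (Suc t) xs)"
      using sub by (metis subseq_filter)
    moreover have "av213 (tops (Suc t) xs)"
      using av213_threshold[of xs] by (simp only: t(1))
    ultimately show False
      using bac(2,3) unfolding av213_def by blast
  qed
  then have "x < a" using t mem assms(2) by (metis le_neq_implies_less)
  moreover have "subseq [x, b, a, c] (x # xs)" using sub by simp
  ultimately show False
    using assms(1) bac(2,3) unfolding av1324_def by blast
qed

text \<open>
  The greedy choice: the threshold \<open>y\<close> of a column is the lowest one for which the remaining points from \<open>y\<close>
  upwards avoid 213, and the column is the longest prefix whose bottoms avoid 132. No later point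
  is above \<open>y\<close>, since it would extend the 132 that stopped the column to a 1324. That the values outside
  \<open>U\<close> lie below the threshold is the induction invariant that keeps the bottoms of different columns
  apart.
\<close>

lemma ex_staircase:
  assumes "distinct xs" "av1324 xs"
  shows "\<exists>U cs. staircase xs U cs \<and> (\<forall>z\<in>set xs - U. z < threshold xs)"
  using assms
proof (induction xs rule: length_induct)
  case (1 xs)
  show ?case
  proof (cases "xs = []")
    case True
    then show ?thesis using staircase.Nil by auto
  next
    case False
    define y where "y = threshold xs"
    define N where "N = {n. n \<le> length xs \<and> av132 (bots y (take n xs))}"
    define n where "n = Max N"
    let ?s = "take n xs" and ?r = "drop n xs"
    \<comment> \<open>A prefix of length 1 qualifies, so the column is nonempty and the recursion proceeds.\<close>
    have "finite N" unfolding N_def by simp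
    moreover have one: "1 \<in> N"
      using False by (cases xs) (auto simp: N_def av132_def)
    ultimately have n: "n \<in> N" "1 \<le> n" and n_max: "\<And>m. m \<in> N \<Longrightarrow> m \<le> n"
      unfolding n_def by (auto intro: Max_in Max_ge)
    have xs: "xs = ?s @ ?r" by simp
    have "subseq ?s xs" "subseq ?r xs"
      by (metis xs subseq_rev_drop_many subseq_order.refl) (metis xs subseq_drop_many subseq_order.refl)
    have "domino y ?s"
      unfolding domino_def
    proof (intro conjI)
      show "av213 (tops y ?s)"
        using av213_threshold av213_subseq subseq_filter[OF \<open>subseq ?s xs\<close>] unfolding y_def by blast
      show "av132 (bots y ?s)" using n by (simp add: N_def)
      show "av1324 ?s" using 1(3) av1324_subseq \<open>subseq ?s xs\<close> by blast
    qed (use 1(2) in simp)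
    then obtain c bs where c: "encodes y ?s c bs"
      using domino_encodes by blast
    have rest_lt: "z < y" if z: "z \<in> set ?r" for z
    proof (rule ccontr)
      assume "\<not> z < y"
      then have "n < length xs" using z by (cases "n < length xs") auto
      define x where "x = xs ! n"
      have s': "take (Suc n) xs = ?s @ [x]" and r: "?r = x # drop (Suc n) xs"
        using \<open>n < length xs\<close> by (auto simp: x_def take_Suc_conv_app_nth Cons_nth_drop_Suc)
      have "Suc n \<notin> N" using n_max[of "Suc n"] by auto
      then have bad: "\<not> av132 (bots y (?s @ [x]))"
        using \<open>n < length xs\<close> s' unfolding N_def by simp
      have good: "av132 (bots y ?s)" using n by (simp add: N_def)
      have "x < y" using bad good by (auto split: if_splits)
      then obtain a b d where abd: "subseq [a, b, d] (bots y ?s @ [x])" "a < d" "d < b"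
        using bad unfolding av132_def by auto
      have "\<not> subseq [a, b, d] (bots y ?s)"
        using good abd unfolding av132_def by blast
      then have "d = x" "subseq [a, b] (bots y ?s)"
        using subseq_snocD[OF abd(1)] by (auto simp: append_eq_Cons_conv Cons_eq_append_conv)
      then have ab: "subseq [a, b] ?s"
        using subseq_filter_left subseq_order.trans by blast
      have "b < y"
        using subseq_set[OF \<open>subseq [a, b] (bots y ?s)\<close>] by simp
      have "z \<in> set (drop (Suc n) xs)" using z r \<open>x < y\<close> \<open>\<not> z < y\<close> by auto
      then have "subseq ([a, b] @ [x, z]) (?s @ x # drop (Suc n) xs)"
        using ab by (intro list_emb_append_mono) (simp_all add: subseq_singleton_left)
      then have "subseq [a, b, x, z] xs"
        using xs r by simp
      moreover have "a < x" "x < b" "b < z"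
        using abd(2,3) \<open>d = x\<close> \<open>b < y\<close> \<open>\<not> z < y\<close> by simp_all
      ultimately show False
        using 1(3) unfolding av1324_def by blast
    qed
    have len: "length ?r < length xs" using n False by simp
    have "distinct ?r" "av1324 ?r"
      using 1(2,3) av1324_subseq \<open>subseq ?r xs\<close> by auto
    then obtain U cs where U: "staircase ?r U cs" "\<forall>z\<in>set ?r - U. z < threshold ?r"
      using 1(1) len by blast
    have below: "threshold ?r \<le> x" if x: "x \<in> set ?s" for x
    proof (rule threshold_le)
      have "subseq ([x] @ ?r) (?s @ ?r)"
        using x by (intro list_emb_append_mono) (simp_all add: subseq_singleton_left)
      then show "av1324 (x # ?r)"
        using 1(3) av1324_subseq by simp
      show "x \<notin> set ?r"
        using x 1(2) xs by (metis disjoint_iff distinct_append)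
    qed
    have "staircase (?s @ ?r) ({x \<in> set ?s. y \<le> x} \<union> U) (c # cs)"
    proof (rule staircase.Cons[OF c _ U(1)])
      show "\<forall>x\<in>set ?s. x < y \<longrightarrow> (\<forall>z\<in>set ?r - U. z < x)"
        using U(2) below by (meson less_le_trans)
    qed (use n False rest_lt in auto)
    moreover have "z < threshold xs" if "z \<in> set xs - ({x \<in> set ?s. y \<le> x} \<union> U)" for z
    proof -
      have "z \<in> set ?s \<or> z \<in> set ?r" using that xs by (metis DiffD1 Un_iff set_append)
      then show ?thesis using that rest_lt y_def by auto
    qed
    ultimately show ?thesis by auto
  qed
qed

text \<open>
  Corresponding entries have the same rank in the common set of values.
\<close>

lemma similar_set_eq:
  assumes "similar y xs y' ys" "distinct xs" "distinct ys" "set xs = set ys"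
  shows "xs = ys"
proof (rule nth_equalityI)
  show len: "length xs = length ys"
    using assms(1) unfolding similar_def by (rule conjunct1)
  have less: "xs ! i < xs ! j \<longleftrightarrow> ys ! i < ys ! j" if "i < length xs" "j < length xs" for i j
  proof -
    have "(xs ! i, ys ! i) \<in> set (zip xs ys)" "(xs ! j, ys ! j) \<in> set (zip xs ys)"
      using that len by (auto simp: set_zip)
    then show ?thesis
      using assms(1) unfolding similar_def by blast
  qed
  fix i assume i: "i < length xs"
  have rank: "card {z \<in> set zs. z < zs ! i} = card {j. j < length zs \<and> zs ! j < zs ! i}"
    if "distinct zs" for zs :: "nat list"
  proof -
    have "{z \<in> set zs. z < zs ! i} = (!) zs ` {j. j < length zs \<and> zs ! j < zs ! i}"
      by (auto simp: set_conv_nth)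
    moreover have "inj_on ((!) zs) {j. j < length zs \<and> zs ! j < zs ! i}"
      using that by (auto simp: inj_on_def nth_eq_iff_index_eq)
    ultimately show ?thesis by (simp add: card_image)
  qed
  have "{j. j < length xs \<and> xs ! j < xs ! i} = {j. j < length ys \<and> ys ! j < ys ! i}"
    using less i len by auto
  then have card: "card {z \<in> set xs. z < xs ! i} = card {z \<in> set xs. z < ys ! i}"
    using rank[OF assms(2)] rank[OF assms(3)] assms(4) by (simp only:)
  have strict: "card {z \<in> set xs. z < a} < card {z \<in> set xs. z < b}" if "a < b" "a \<in> set xs" for a b
    using that by (intro psubset_card_mono) auto
  have mem: "xs ! i \<in> set xs" "ys ! i \<in> set xs"
    using nth_mem[OF i] nth_mem[of i ys] i unfolding len assms(4) by simp_all
  show "xs ! i = ys ! i"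
    using strict[OF _ mem(1), of "ys ! i"] strict[OF _ mem(2), of "xs ! i"] card
    by (cases "xs ! i" "ys ! i" rule: linorder_cases) simp_all
qed

lemma upper_set_unique:
  fixes A B V :: "nat set"
  assumes "A \<subseteq> V" "B \<subseteq> V" "finite V" "card A = card B"
    and "\<forall>a\<in>A. \<forall>z\<in>V - A. z < a" "\<forall>a\<in>B. \<forall>z\<in>V - B. z < a"
  shows "A = B"
proof -
  have "A \<subseteq> B \<or> B \<subseteq> A"
  proof (rule ccontr)
    assume "\<not> (A \<subseteq> B \<or> B \<subseteq> A)"
    then obtain a b where ab: "a \<in> A" "a \<notin> B" "b \<in> B" "b \<notin> A" by blast
    then have "a \<in> V - B" "b \<in> V - A" using assms(1,2) by auto
    then have "b < a" "a < b" using ab assms(5,6) by auto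
    then show False by simp
  qed
  moreover have "finite A" "finite B"
    using assms finite_subset by blast+
  ultimately show ?thesis
    using card_subset_eq[of B A] card_subset_eq[of A B] assms(4) by auto
qed

inductive_cases staircase_ConsE: "staircase xs U (c # cs)"

text \<open>
  The columns are read off one by one. The code of the first column gives the numbers of its tops and
  of its bottoms; its tops are that many of the largest values, and its bottoms are that many of the
  largest values outside \<open>U\<close>. So the value set of the column is known, and the code fixes the order.
\<close>

lemma staircase_unique:
  assumes "staircase xs U cs" "staircase ys U cs" "set xs = set ys" "distinct xs" "distinct ys"
  shows "xs = ys"
  using assms
proof (induction arbitrary: ys rule: staircase.induct)
  case Nil
  then show ?case by simp
next
  case (Cons y s c bs xs U cs)
  from Cons.prems(1) obtain y' s' bs' xs' U' where *: "ys = s' @ xs'"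
    "{x \<in> set s. y \<le> x} \<union> U = {x \<in> set s'. y' \<le> x} \<union> U'" "encodes y' s' c bs'" "staircase xs' U' cs"
    "\<forall>z\<in>set xs'. z < y'" "\<forall>x\<in>set s'. x < y' \<longrightarrow> (\<forall>z\<in>set xs' - U'. z < x)"
    by (rule staircase_ConsE) (rule that; assumption)
  have sim: "similar y s y' s'"
    using encodes_unique[OF Cons.hyps(1) *(3)] by simp
  have sets: "set s \<union> set xs = set s' \<union> set xs'" "distinct s" "distinct s'"
    "set s \<inter> set xs = {}" "set s' \<inter> set xs' = {}" "distinct xs" "distinct xs'"
    using Cons.prems *(1) by auto
  have U: "U \<subseteq> set xs" "U' \<subseteq> set xs'"
    using staircase_props Cons.hyps(3) *(4) by blast+
  have len: "length (tops y s) = length (tops y' s')" "length (bots y s) = length (bots y' s')"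
  proof -
    have "length s = length s'" "\<forall>(a, b)\<in>set (zip s s'). y \<le> a \<longleftrightarrow> y' \<le> b"
      using sim unfolding similar_def by blast+
    moreover from this have "\<forall>(a, b)\<in>set (zip s s'). a < y \<longleftrightarrow> b < y'"
      by (simp only: not_le[symmetric]) blast
    ultimately show "length (tops y s) = length (tops y' s')" "length (bots y s) = length (bots y' s')"
      by (blast intro: conjunct2[OF zip_filter])+
  qed
  have tops_eq: "set (tops y s) = set (tops y' s')"
  proof (rule upper_set_unique[of _ "set s \<union> set xs"])
    show "card (set (tops y s)) = card (set (tops y' s'))"
      using len sets by (simp add: distinct_card del: set_filter)
    show "\<forall>a\<in>set (tops y s). \<forall>z\<in>set s \<union> set xs - set (tops y s). z < a"
      using Cons.hyps(4) by force
    show "\<forall>a\<in>set (tops y' s'). \<forall>z\<in>set s \<union> set xs - set (tops y' s'). z < a"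
      using *(5) sets(1) by force
  qed (use sets in auto)
  have U_eq: "U = U'"
  proof -
    have disj: "U \<inter> set (tops y s) = {}" "U' \<inter> set (tops y' s') = {}"
      using U sets(4,5) by auto
    have "set (tops y s) \<union> U = set (tops y' s') \<union> U'"
      using *(2) by (simp only: set_filter)
    moreover have "U = (set (tops y s) \<union> U) - set (tops y s)" "U' = (set (tops y' s') \<union> U') - set (tops y' s')"
      using disj by blast+
    ultimately show ?thesis by (metis tops_eq)
  qed
  have bots_eq: "set (bots y s) = set (bots y' s')"
  proof (rule upper_set_unique[of _ "set s \<union> set xs - (set (tops y s) \<union> U)"])
    show "card (set (bots y s)) = card (set (bots y' s'))"
      using len sets by (simp add: distinct_card del: set_filter)
    show "set (bots y s) \<subseteq> set s \<union> set xs - (set (tops y s) \<union> U)"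
      using U(1) sets(4) by auto
    show "set (bots y' s') \<subseteq> set s \<union> set xs - (set (tops y s) \<union> U)"
      unfolding tops_eq U_eq sets(1) using U(2) sets(5) by auto
    show "\<forall>a\<in>set (bots y s). \<forall>z\<in>set s \<union> set xs - (set (tops y s) \<union> U) - set (bots y s). z < a"
    proof -
      have "set s \<union> set xs - (set (tops y s) \<union> U) - set (bots y s) \<subseteq> set xs - U"
        by auto
      then show ?thesis using Cons.hyps(5) by auto
    qed
    show "\<forall>a\<in>set (bots y' s'). \<forall>z\<in>set s \<union> set xs - (set (tops y s) \<union> U) - set (bots y' s'). z < a"
    proof -
      have "set s' \<union> set xs' - (set (tops y' s') \<union> U') - set (bots y' s') \<subseteq> set xs' - U'"
        by auto
      then show ?thesis unfolding tops_eq U_eq sets(1) using *(6) by auto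
    qed
  qed simp
  have "set s = set (tops y s) \<union> set (bots y s)" "set s' = set (tops y' s') \<union> set (bots y' s')"
    by auto
  then have "set s = set s'" using tops_eq bots_eq by simp
  then have "s = s'" by (rule similar_set_eq[OF sim sets(2,3)])
  moreover have "set xs = set xs'"
  proof -
    have "set xs = (set s \<union> set xs) - set s" "set xs' = (set s' \<union> set xs') - set s'"
      using sets(4,5) by blast+
    then show ?thesis using \<open>set s = set s'\<close> sets(1) by metis
  qed
  then have "xs = xs'"
    using *(4) unfolding U_eq[symmetric] by (intro Cons.IH sets(6,7))
  ultimately show ?case using *(1) by simp
qed

section \<open>Coefficientwise order on power series\<close>

unbundle fps_syntax

definition nonneg_fps :: "real fps \<Rightarrow> bool" where
  "nonneg_fps f \<longleftrightarrow> (\<forall>n. 0 \<le> f $ n)"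

definition le_fps :: "real fps \<Rightarrow> real fps \<Rightarrow> bool" where
  "le_fps f g \<longleftrightarrow> (\<forall>n. f $ n \<le> g $ n)"

lemma nonneg_fps_add: "nonneg_fps f \<Longrightarrow> nonneg_fps g \<Longrightarrow> nonneg_fps (f + g)"
  by (simp add: nonneg_fps_def)

lemma nonneg_fps_mult: "nonneg_fps f \<Longrightarrow> nonneg_fps g \<Longrightarrow> nonneg_fps (f * g)"
  by (auto simp: nonneg_fps_def fps_mult_nth intro!: sum_nonneg)

lemma nonneg_fps_const: "c \<ge> 0 \<Longrightarrow> nonneg_fps (fps_const c)"
  by (simp add: nonneg_fps_def)

lemma nonneg_fps_one: "nonneg_fps 1"
  by (simp add: nonneg_fps_def)

lemma nonneg_fps_X: "nonneg_fps fps_X"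
  by (simp add: nonneg_fps_def fps_X_def)

lemma nonneg_fps_power: "nonneg_fps f \<Longrightarrow> nonneg_fps (f ^ n)"
  by (induction n) (auto intro: nonneg_fps_mult nonneg_fps_one)

lemma nonneg_fps_sum: "(\<And>x. x \<in> A \<Longrightarrow> nonneg_fps (f x)) \<Longrightarrow> nonneg_fps (sum f A)"
  by (auto simp: nonneg_fps_def fps_sum_nth intro: sum_nonneg)

lemmas nonneg_fps_intros = nonneg_fps_add nonneg_fps_mult nonneg_fps_const
  nonneg_fps_one nonneg_fps_X nonneg_fps_power

text \<open>
  The geometric series argument, with the hypothesis restricted to the coefficients up to \<open>n\<close>. This form
  allows a series to be shown nonnegative by induction from an equation that contains an inverse of itself.
\<close>

lemma inverse_nth_nonneg:
  fixes f :: "real fps"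
  assumes f0: "f $ 0 > 0" and f: "\<And>i. 0 < i \<Longrightarrow> i \<le> n \<Longrightarrow> f $ i \<le> 0"
  shows "m \<le> n \<Longrightarrow> 0 \<le> inverse f $ m"
proof (induction m rule: less_induct)
  case (less m)
  have inv: "f * inverse f = 1"
    using f0 by (simp add: inverse_mult_eq_1')
  show ?case
  proof (cases "m = 0")
    case True
    then show ?thesis using f0 by simp
  next
    case False
    have "0 = (\<Sum>i=0..m. f $ i * inverse f $ (m - i))"
      using inv False by (metis fps_mult_nth fps_one_nth)
    also have "\<dots> = f $ 0 * inverse f $ m + (\<Sum>i=Suc 0..m. f $ i * inverse f $ (m - i))"
      by (simp add: sum.atLeast_Suc_atMost)
    finally have "f $ 0 * inverse f $ m = - (\<Sum>i=Suc 0..m. f $ i * inverse f $ (m - i))"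
      by simp
    moreover have "(\<Sum>i=Suc 0..m. f $ i * inverse f $ (m - i)) \<le> 0"
      using less by (intro sum_nonpos) (auto intro!: mult_nonpos_nonneg f)
    ultimately have "f $ 0 * inverse f $ m \<ge> 0" by simp
    then show ?thesis using f0 by (simp add: zero_le_mult_iff)
  qed
qed

lemma nonneg_fps_inverse_diff:
  assumes "nonneg_fps f" "f $ 0 < c"
  shows "nonneg_fps (inverse (fps_const c - f))"
  unfolding nonneg_fps_def
proof
  fix n
  show "0 \<le> inverse (fps_const c - f) $ n"
    by (rule inverse_nth_nonneg[of _ n]) (use assms in \<open>auto simp: nonneg_fps_def\<close>)
qed

lemma le_fps_add: "le_fps a b \<Longrightarrow> le_fps c d \<Longrightarrow> le_fps (a + c) (b + d)"
  by (auto simp: le_fps_def intro: add_mono)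

lemma le_fps_mult:
  "le_fps a b \<Longrightarrow> le_fps c d \<Longrightarrow> nonneg_fps a \<Longrightarrow> nonneg_fps d \<Longrightarrow> le_fps (a * c) (b * d)"
  unfolding le_fps_def nonneg_fps_def fps_mult_nth
  by (intro allI sum_mono order_trans[OF mult_left_mono mult_right_mono]) auto

lemma le_fps_trans: "le_fps a b \<Longrightarrow> le_fps b c \<Longrightarrow> le_fps a c"
  unfolding le_fps_def using order_trans by blast

lemma le_fps_refl: "le_fps f f" by (simp add: le_fps_def)

lemma sum_fps_mono_set:
  assumes "finite B" "A \<subseteq> B" "\<And>x. x \<in> B \<Longrightarrow> nonneg_fps (f x)"
  shows "le_fps (sum f A) (sum f B)"
  using assms by (auto simp: le_fps_def nonneg_fps_def fps_sum_nth intro!: sum_mono2)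

lemma sum_fps_Un_le:
  assumes "finite A" "finite B" "\<And>x. x \<in> A \<union> B \<Longrightarrow> nonneg_fps (f x)"
  shows "le_fps (sum f (A \<union> B)) (sum f A + sum f B)"
proof -
  have "sum f (A \<union> B) + sum f (A \<inter> B) = sum f A + sum f B"
    using assms by (simp add: sum.union_inter)
  moreover have "nonneg_fps (sum f (A \<inter> B))"
    by (rule nonneg_fps_sum) (use assms in auto)
  ultimately show ?thesis
    unfolding le_fps_def nonneg_fps_def
    by (metis fps_add_nth add_increasing2 order_refl)
qed

section \<open>The critical solution of the functional equation\<close>

text \<open>
  At \<open>z = 4/27\<close> the functional equation becomes a quadratic equation for \<open>F\<close> once \<open>F(1) = 27/16\<close> is inserted,
  and its discriminant is, up to a square factor, \<open>(1 - 2 v) ^ 3 * (9 - 2 v)\<close> with \<open>v = u - 1\<close>, here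
  \<open>fps_X\<close>. The triple root is what makes \<open>27/16\<close> the right value. The square root of
  \<open>(1 - 2 v) / (9 - 2 v)\<close> therefore rationalises the solution. Of all its Moebius transforms,
  \<open>omega\<close> is chosen such that it vanishes at \<open>v = 0\<close>, has nonnegative coefficients, and makes the
  derivative of the solution a rational function of \<open>omega\<close> with the single denominator
  \<open>omega_quad\<^sup>2\<close> (\<open>crit_G_deriv_eq\<close>).
\<close>

definition omega :: "real fps" where
  "omega = 1 - fps_radical (\<lambda>n x. root n x) 2 ((1 - fps_const 2 * fps_X) * inverse (1 - fps_const (2/9) * fps_X))"

lemma omega_0: "omega $ 0 = 0"
  by (simp add: omega_def)

lemma omega_eq: "2 * fps_X * (2 + omega) * (4 - omega) = 9 * omega * (2 - omega)"
proof -
  define a :: "real fps" where "a = (1 - fps_const 2 * fps_X) * inverse (1 - fps_const (2/9) * fps_X)"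
  have a0: "a $ 0 = 1" by (simp add: a_def)
  have "(fps_radical (\<lambda>n x. root n x) (Suc 1) a) ^ Suc 1 = a"
    using a0 by (intro iffD1[OF power_radical]) auto
  then have "(1 - omega) ^ 2 = a"
    by (simp add: omega_def a_def numeral_2_eq_2)
  moreover have "a * (1 - fps_const (2/9) * fps_X) = 1 - fps_const 2 * fps_X"
    unfolding a_def by (simp add: mult.assoc inverse_mult_eq_1)
  ultimately have *: "(1 - omega)\<^sup>2 * (1 - fps_const (2/9) * fps_X) = 1 - fps_const 2 * fps_X"
    by simp
  have c: "9 * fps_const (2/9::real) = 2" "fps_const 2 = (2 :: real fps)"
    by (simp_all add: numeral_fps_const)
  have "(1 - omega)\<^sup>2 * (9 * 1 - (9 * fps_const (2/9)) * fps_X) = 9 * ((1 - omega)\<^sup>2 * (1 - fps_const (2/9) * fps_X))"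
    by (simp add: algebra_simps)
  also have "\<dots> = 9 * (1 - 2 * fps_X)" by (simp add: * c)
  finally have "(1 - omega)\<^sup>2 * (9 - 2 * fps_X) = 9 * (1 - 2 * fps_X)" by (simp add: c)
  then show ?thesis by algebra
qed

text \<open>
  Solving \<open>omega_eq\<close> for the linear term gives
  \<open>9 omega = 2 v (2 + omega) (1 + 2 / (2 - omega))\<close>. The right-hand side has
  nonnegative operations only, and its coefficient at \<open>n + 1\<close> depends on those of \<open>omega\<close> up to \<open>n\<close>.
\<close>

lemma nonneg_omega: "nonneg_fps omega"
proof -
  have inv: "(2 - omega) * inverse (2 - omega) = 1"
    by (rule inverse_mult_eq_1') (simp add: omega_0)
  have "9 * omega = 9 * omega * ((2 - omega) * inverse (2 - omega))"
    by (simp add: inv)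
  also have "\<dots> = 2 * fps_X * (2 + omega) * ((2 - omega) * inverse (2 - omega) + 2 * inverse (2 - omega))"
    using omega_eq by algebra
  finally have omega9: "9 * omega = fps_X * (2 * (2 + omega) * (1 + 2 * inverse (2 - omega)))"
    by (simp only: inv) (simp add: algebra_simps)
  have "\<forall>i\<le>n. 0 \<le> omega $ i" for n
  proof (induction n)
    case 0
    then show ?case by (simp add: omega_0)
  next
    case (Suc n)
    have inv_nn: "0 \<le> inverse (2 - omega) $ i" if "i \<le> n" for i
      by (rule inverse_nth_nonneg[of _ n]) (use Suc that omega_0 in \<open>auto simp: numeral_fps_const\<close>)
    have "9 * omega $ Suc n = (9 * omega) $ Suc n" by (simp add: numeral_fps_const)
    also have "\<dots> = (2 * (2 + omega) * (1 + 2 * inverse (2 - omega))) $ n"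
      by (simp only: omega9) simp
    also have "\<dots> = (\<Sum>i=0..n. (2 * (2 + omega)) $ i * (1 + 2 * inverse (2 - omega)) $ (n - i))"
      by (simp add: fps_mult_nth)
    also have "\<dots> \<ge> 0"
      using inv_nn Suc by (intro sum_nonneg mult_nonneg_nonneg) (auto simp: numeral_fps_const)
    finally have "0 \<le> omega $ Suc n" by simp
    then show ?case using Suc by (auto simp: le_Suc_eq)
  qed
  then show ?thesis by (auto simp: nonneg_fps_def)
qed

definition omega_quad :: "real fps" where "omega_quad = 64 - 38 * omega + omega\<^sup>2"

lemma omega_quad_0: "omega_quad $ 0 = 64"
  by (simp add: omega_quad_def omega_0 numeral_fps_const power2_eq_square)

text \<open>
  This is \<open>z = 4/27\<close> times the solution of the functional equation, written in \<open>omega\<close>.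
\<close>

definition crit_G :: "real fps" where "crit_G = (2 + omega) * (8 - 5 * omega) * inverse omega_quad"

lemma crit_G_0: "crit_G $ 0 = 1 / 4"
  by (simp add: crit_G_def omega_0 omega_quad_0 numeral_fps_const)

lemma crit_G_eq: "omega_quad * crit_G = (2 + omega) * (8 - 5 * omega)"
proof -
  have "omega_quad * inverse omega_quad = 1" by (rule inverse_mult_eq_1') (simp add: omega_quad_0)
  then show ?thesis unfolding crit_G_def by algebra
qed

text \<open>
  The part of the solution that stands for the dominoes ending with a top, \<open>z F / (1 - z F)\<close>.
\<close>

definition crit_T :: "real fps" where "crit_T = crit_G * inverse (1 - crit_G)"

lemma one_minus_crit_G_eq: "omega_quad * (1 - crit_G) = 6 * (2 - omega) * (4 - omega)"
  using crit_G_eq unfolding omega_quad_def by algebra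

lemma crit_T_fix: "crit_T = crit_G + crit_G * crit_T"
proof -
  have "(1 - crit_G) * inverse (1 - crit_G) = 1" by (rule inverse_mult_eq_1') (simp add: crit_G_0)
  then show ?thesis unfolding crit_T_def by algebra
qed

lemma crit_T_eq: "6 * (2 - omega) * (4 - omega) * crit_T = (2 + omega) * (8 - 5 * omega)"
proof -
  have "omega_quad * ((1 - crit_G) * crit_T) = omega_quad * crit_G" using crit_T_fix by algebra
  then show ?thesis using one_minus_crit_G_eq crit_G_eq by algebra
qed

text \<open>
  The functional equation multiplied by \<open>4 v\<close>. The term \<open>1 + fps_X\<close> is \<open>4 (1 + v) z F(1)\<close>, where
  \<open>F(1)\<close> is the value at \<open>u = 1\<close> and \<open>z F(1) = 1/4\<close>.
\<close>

lemma kernel_eq: "fps_X * (27 * crit_G - 4 - 4 * crit_T) = 4 * (1 + fps_X)\<^sup>2 * crit_G - (1 + fps_X)"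
proof -
  \<comment> \<open>Multiplied by the common denominator of \<open>v\<close>, \<open>crit_G\<close> and \<open>crit_T\<close>, the claim is a polynomial identity
      modulo their defining equations.\<close>
  have "(omega_quad * (2 - omega) * ((2 + omega) * (4 - omega))\<^sup>2) * (fps_X * (27 * crit_G - 4 - 4 * crit_T) - (4 * (1 + fps_X)\<^sup>2 * crit_G - (1 + fps_X))) = 0"
    using omega_eq crit_G_eq crit_T_eq unfolding omega_quad_def by algebra
  moreover have "omega_quad * (2 - omega) * ((2 + omega) * (4 - omega))\<^sup>2 \<noteq> 0"
  proof
    assume "omega_quad * (2 - omega) * ((2 + omega) * (4 - omega))\<^sup>2 = 0"
    then have "(omega_quad * (2 - omega) * ((2 + omega) * (4 - omega))\<^sup>2) $ 0 = 0 $ 0" by (rule arg_cong)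
    then show False by (simp add: omega_0 omega_quad_0 power2_eq_square numeral_fps_const del: mult_eq_0_iff power_eq_0_iff)
  qed
  ultimately show ?thesis by (metis mult_eq_0_iff right_minus_eq)
qed

text \<open>
  The coefficients of \<open>crit_G\<close> as a rational function of \<open>omega\<close> have both signs. Those of its derivative
  with respect to \<open>v\<close> do not: the chain rule contributes the factor \<open>1 / (1 - omega)\<close>, which
  cancels the critical factor \<open>1 - omega\<close> of the outer derivative.
\<close>

lemma crit_G_deriv_eq: "72 * (omega_quad\<^sup>2 * fps_deriv crit_G) = 96 * ((5 - 2 * omega) * ((2 + omega) * (4 - omega))\<^sup>2)"
proof -
  have dn: "fps_deriv (numeral n) = (0 :: real fps)" for n by (simp add: numeral_fps_const)
  have "fps_deriv (2 * fps_X * (2 + omega) * (4 - omega)) = fps_deriv (9 * omega * (2 - omega))"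
    by (simp only: omega_eq)
  then have domega: "2 * (2 + omega) * (4 - omega) + 4 * fps_X * (1 - omega) * fps_deriv omega = 18 * (1 - omega) * fps_deriv omega"
    by (simp add: dn) algebra
  have "fps_deriv (omega_quad * crit_G) = fps_deriv ((2 + omega) * (8 - 5 * omega))"
    by (simp only: crit_G_eq)
  then have dG: "(2 * omega - 38) * fps_deriv omega * crit_G + omega_quad * fps_deriv crit_G = - (2 + 10 * omega) * fps_deriv omega"
    unfolding omega_quad_def by (simp add: dn power2_eq_square) algebra
  have "2 * ((2 + omega) * (4 - omega))\<^sup>2 + 2 * (1 - omega) * fps_deriv omega * (2 * fps_X * (2 + omega) * (4 - omega))
      = 18 * (1 - omega) * fps_deriv omega * ((2 + omega) * (4 - omega))"
    using domega by algebra
  then have "2 * ((2 + omega) * (4 - omega))\<^sup>2 = 2 * (72 * ((1 - omega) * fps_deriv omega))"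
    unfolding omega_eq by algebra
  then have W: "72 * ((1 - omega) * fps_deriv omega) = ((2 + omega) * (4 - omega))\<^sup>2"
    by (metis mult_left_cancel zero_neq_numeral)
  have "omega_quad\<^sup>2 * fps_deriv crit_G = - (2 + 10 * omega) * fps_deriv omega * omega_quad - (2 * omega - 38) * fps_deriv omega * (omega_quad * crit_G)"
    using dG by algebra
  also have "\<dots> = 96 * (5 - 2 * omega) * ((1 - omega) * fps_deriv omega)"
    unfolding crit_G_eq unfolding omega_quad_def by algebra
  finally have "72 * (omega_quad\<^sup>2 * fps_deriv crit_G) = 96 * (5 - 2 * omega) * ((2 + omega) * (4 - omega))\<^sup>2"
    using W by algebra
  then show ?thesis by (simp only: mult.assoc)
qed

lemma nonneg_fps_numeral: "nonneg_fps (numeral n)"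
  by (simp add: nonneg_fps_def numeral_fps_const)

lemma omega_quad_inverse: "omega_quad * inverse omega_quad = 1"
  by (rule inverse_mult_eq_1') (simp add: omega_quad_0)

lemma nonneg_fps_numeral_mult_iff: "nonneg_fps (numeral n * f) \<longleftrightarrow> nonneg_fps f"
  by (simp add: nonneg_fps_def numeral_fps_const zero_le_mult_iff)

text \<open>
  The root 2 of the numerator lies between the two roots of the denominator, so division with remainder
  gives \<open>omega_quad = (2 - omega) (36 - omega - 8 / (2 - omega))\<close>, and the quotient is the inverse of a
  constant minus a nonnegative series.
\<close>

lemma nonneg_quotient_omega_quad: "nonneg_fps ((2 - omega) * inverse omega_quad)"
proof -
  have inv: "(2 - omega) * inverse (2 - omega) = 1"
    by (rule inverse_mult_eq_1') (simp add: omega_0)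
  define f where "f = omega + 8 * inverse (2 - omega)"
  have nn: "nonneg_fps (inverse (2 - omega))"
    using nonneg_fps_inverse_diff[OF nonneg_omega, of 2] by (simp add: omega_0 numeral_fps_const)
  have f0: "f $ 0 = 4" by (simp add: f_def omega_0 numeral_fps_const)
  have "nonneg_fps (inverse (fps_const 36 - f))"
  proof (rule nonneg_fps_inverse_diff)
    show "nonneg_fps f"
      unfolding f_def by (intro nonneg_fps_intros nonneg_fps_numeral nonneg_omega nn)
  qed (simp add: f0)
  moreover have "inverse (36 - f) = (2 - omega) * inverse omega_quad"
  proof (rule fps_inverse_unique)
    have "omega_quad = (2 - omega) * (36 - f)"
      using inv unfolding f_def omega_quad_def by algebra
    then show "(36 - f) * ((2 - omega) * inverse omega_quad) = 1"
      using omega_quad_inverse by algebra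
  qed
  ultimately show ?thesis by (simp add: numeral_fps_const)
qed

text \<open>
  With \<open>E = (2 + omega) (4 - omega) / omega_quad\<close> the derivative is a positive multiple of
  \<open>((5 - 2 omega) E) E\<close>. Both \<open>E\<close> and \<open>(5 - 2 omega) E\<close> are nonnegative: \<open>E\<close> differs from a nonnegative
  quotient by a constant and has constant term \<open>1/8\<close>, and in \<open>(5 - 2 omega) E\<close> splitting off the two lowest terms in \<open>omega\<close> leaves a
  numerator with positive coefficients. Since the constant term of \<open>crit_G\<close> is positive too, this suffices.
\<close>

lemma nonneg_crit_G: "nonneg_fps crit_G"
proof -
  define E where "E = (2 + omega) * (4 - omega) * inverse omega_quad"
  have inv2: "(2 - omega) * inverse (2 - omega) = 1"
    by (rule inverse_mult_eq_1') (simp add: omega_0)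
  have nn2: "nonneg_fps (inverse (2 - omega))"
    using nonneg_fps_inverse_diff[OF nonneg_omega, of 2] by (simp add: omega_0 numeral_fps_const)
  have E_eq: "E = 36 * ((2 - omega) * inverse omega_quad) - 1"
    using omega_quad_inverse unfolding E_def omega_quad_def by algebra
  have nnE: "nonneg_fps E"
    unfolding nonneg_fps_def
  proof
    fix n
    show "0 \<le> E $ n"
    proof (cases "n = 0")
      case True
      then show ?thesis by (simp add: E_def omega_0 omega_quad_0)
    next
      case False
      have "nonneg_fps (36 * ((2 - omega) * inverse omega_quad))"
        by (simp only: nonneg_fps_numeral_mult_iff nonneg_quotient_omega_quad)
      then show ?thesis
        unfolding E_eq nonneg_fps_def using False by simp
    qed
  qed
  have nnQ: "nonneg_fps (inverse omega_quad)"
  proof -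
    have "inverse omega_quad = ((2 - omega) * inverse omega_quad) * inverse (2 - omega)"
      using inv2 by algebra
    then show ?thesis
      using nonneg_fps_mult[OF nonneg_quotient_omega_quad nn2] by (simp only:)
  qed
  have "256 * ((5 - 2 * omega) * E) = 160 + 71 * omega + omega\<^sup>2 * (234 + 441 * omega) * inverse omega_quad"
    using omega_quad_inverse unfolding E_def omega_quad_def by algebra
  then have "nonneg_fps (256 * ((5 - 2 * omega) * E))"
    by (simp only:) (intro nonneg_fps_intros nonneg_fps_numeral nonneg_omega nnQ)
  then have "nonneg_fps (96 * (((5 - 2 * omega) * E) * E))"
    unfolding nonneg_fps_numeral_mult_iff by (rule nonneg_fps_mult[OF _ nnE])
  moreover have "72 * fps_deriv crit_G = 96 * (((5 - 2 * omega) * E) * E)"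
  proof -
    have "72 * fps_deriv crit_G = 72 * fps_deriv crit_G * (omega_quad * inverse omega_quad)\<^sup>2"
      by (simp only: omega_quad_inverse) simp
    also have "\<dots> = 72 * (omega_quad\<^sup>2 * fps_deriv crit_G) * (inverse omega_quad)\<^sup>2"
      by (simp only: power_mult_distrib mult_ac)
    also have "\<dots> = 96 * (((5 - 2 * omega) * E) * E)"
      unfolding crit_G_deriv_eq E_def by (simp only: power2_eq_square mult_ac)
    finally show ?thesis .
  qed
  ultimately have "nonneg_fps (72 * fps_deriv crit_G)"
    by (simp only:)
  then have "nonneg_fps (fps_deriv crit_G)"
    by (simp only: nonneg_fps_numeral_mult_iff)
  then have d: "0 \<le> real (n + 1) * crit_G $ (n + 1)" for n
    by (simp add: nonneg_fps_def)
  have "0 \<le> crit_G $ n" for n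
  proof (cases n)
    case (Suc m)
    then show ?thesis using d[of m] by (simp add: zero_le_mult_iff)
  qed (simp add: crit_G_0)
  then show ?thesis by (simp add: nonneg_fps_def)
qed

lemma nonneg_crit_T: "nonneg_fps crit_T"
proof -
  have "nonneg_fps (inverse (fps_const 1 - crit_G))"
    by (rule nonneg_fps_inverse_diff) (auto simp: crit_G_0 nonneg_crit_G)
  then show ?thesis unfolding crit_T_def by (simp add: nonneg_fps_mult nonneg_crit_G)
qed

section \<open>Counting domino codes\<close>

definition codes :: "nat \<Rightarrow> dcode set" where
  "codes N = {c. valid c \<and> points c \<le> N}"

definition top_codes :: "nat \<Rightarrow> dcode set" where
  "top_codes N = {c \<in> codes N. ends_top c}"

lemma codes_0: "codes 0 = {Empty}" "top_codes 0 = {}"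
proof -
  have "c = Empty" if "points c = 0" for c
    using that by (cases c) auto
  then show "codes 0 = {Empty}"
    by (auto simp: codes_def)
  then show "top_codes 0 = {}"
    by (simp add: top_codes_def)
qed

lemma top_codes_Suc:
  "top_codes (Suc N) \<subseteq> AddTop ` codes N \<union> case_prod AddTopAbove ` (codes N \<times> top_codes N)"
proof
  fix c assume "c \<in> top_codes (Suc N)"
  then show "c \<in> AddTop ` codes N \<union> case_prod AddTopAbove ` (codes N \<times> top_codes N)"
    by (cases c) (auto simp: codes_def top_codes_def)
qed

lemma codes_Suc:
  "codes (Suc N) \<subseteq> insert Empty (case_prod AddBot ` (SIGMA c:codes N. {..comps c})) \<union> top_codes (Suc N)"
proof
  fix c assume "c \<in> codes (Suc N)"
  then show "c \<in> insert Empty (case_prod AddBot ` (SIGMA c:codes N. {..comps c})) \<union> top_codes (Suc N)"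
    by (cases c) (auto simp: codes_def top_codes_def)
qed

lemma finite_codes: "finite (codes N)"
proof (induction N)
  case (Suc N)
  have "finite (top_codes N)"
    using Suc by (simp add: top_codes_def)
  then have "finite (top_codes (Suc N))"
    using Suc by (intro finite_subset[OF top_codes_Suc]) auto
  then show ?case
    using Suc by (intro finite_subset[OF codes_Suc]) auto
qed (simp add: codes_0)

lemma finite_top_codes: "finite (top_codes N)"
  using finite_codes by (simp add: top_codes_def)

text \<open>
  The generating function is expanded in \<open>v = u - 1\<close>, hence the factor \<open>(1 + fps_X) ^ comps c\<close> in place of a
  power of \<open>u\<close>. In powers of \<open>u\<close> the divided difference \<open>(F(u) - F(1)) / (u - 1)\<close> would be a sum over tails;
  in powers of \<open>v\<close> it is a mere shift.
\<close>

definition wt :: "dcode \<Rightarrow> real fps" where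
  "wt c = fps_const ((4/27) ^ points c) * (1 + fps_X) ^ comps c"

lemma nonneg_wt: "nonneg_fps (wt c)"
  unfolding wt_def by (intro nonneg_fps_intros) auto

text \<open>
  The operator \<open>u F(u) + u (F(u) - F(1)) / (u - 1)\<close>, which describes the insertion of a last bottom, in the
  variable \<open>v = u - 1\<close>.
\<close>

definition bot_op :: "real fps \<Rightarrow> real fps" where
  "bot_op f = (1 + fps_X) * (f + fps_shift 1 f)"

lemma bot_op_add: "bot_op (f + g) = bot_op f + bot_op g"
  by (simp add: bot_op_def fps_shift_add algebra_simps)

lemma bot_op_sum: "bot_op (sum f A) = (\<Sum>x\<in>A. bot_op (f x))"
  by (induction A rule: infinite_finite_induct) (auto simp: bot_op_add, auto simp: bot_op_def)

lemma bot_op_const_mult: "bot_op (fps_const a * f) = fps_const a * bot_op f"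
proof -
  have "fps_shift 1 (fps_const a * f) = fps_const a * fps_shift 1 f"
    by (rule fps_ext) simp
  then show ?thesis by (simp add: bot_op_def algebra_simps)
qed

lemma X_mult_bot_op: "fps_X * bot_op f = (1 + fps_X)\<^sup>2 * f - (1 + fps_X) * fps_const (f $ 0)"
proof -
  have "fps_X * fps_shift 1 f = f - fps_const (f $ 0)"
    by (rule fps_ext) (auto simp: fps_X_mult_nth)
  then show ?thesis unfolding bot_op_def by algebra
qed

lemma le_fps_bot_op: "le_fps f g \<Longrightarrow> le_fps (bot_op f) (bot_op g)"
proof -
  assume *: "le_fps f g"
  have "le_fps (fps_shift 1 f) (fps_shift 1 g)"
    using * by (simp add: le_fps_def)
  then have "le_fps (f + fps_shift 1 f) (g + fps_shift 1 g)"
    using * by (intro le_fps_add)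
  moreover from this have "le_fps (fps_X * (f + fps_shift 1 f)) (fps_X * (g + fps_shift 1 g))"
    unfolding le_fps_def
  proof (intro allI)
    fix n
    assume "\<forall>n. (f + fps_shift 1 f) $ n \<le> (g + fps_shift 1 g) $ n"
    then show "(fps_X * (f + fps_shift 1 f)) $ n \<le> (fps_X * (g + fps_shift 1 g)) $ n"
      by (cases n) (simp_all add: fps_X_mult_nth)
  qed
  ultimately show ?thesis
    unfolding bot_op_def by (simp only: distrib_right mult_1 le_fps_add)
qed

text \<open>
  A domino with \<open>k\<close> bottom components has \<open>k + 1\<close> places for a last bottom, and the results have \<open>1\<close> up to
  \<open>k + 1\<close> components. After multiplication by \<open>v\<close> this is a geometric sum.
\<close>

lemma sum_comps_bot_op: "(\<Sum>r\<le>k. (1 + fps_X) ^ Suc r) = bot_op ((1 + fps_X) ^ k)"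
proof -
  have "fps_X * (\<Sum>r\<le>k. (1 + fps_X :: real fps) ^ Suc r) = (1 + fps_X) * ((1 + fps_X) ^ Suc k - 1)"
    by (induction k) (auto simp: algebra_simps)
  also have "\<dots> = fps_X * bot_op ((1 + fps_X) ^ k)"
    unfolding X_mult_bot_op by (simp add: fps_nth_power_0 algebra_simps power2_eq_square)
  finally show ?thesis by (simp only: mult_left_cancel[OF fps_X_neq_zero])
qed

lemma sum_wt_AddBot:
  "(\<Sum>c\<in>case_prod AddBot ` (SIGMA c:codes N. {..comps c}). wt c) = fps_const (4/27) * bot_op (\<Sum>c\<in>codes N. wt c)"
proof -
  have "(\<Sum>c\<in>case_prod AddBot ` (SIGMA c:codes N. {..comps c}). wt c)
      = (\<Sum>(c, r)\<in>(SIGMA c:codes N. {..comps c}). wt (AddBot c r))"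
    by (subst sum.reindex) (auto simp: inj_on_def case_prod_unfold)
  also have "\<dots> = (\<Sum>c\<in>codes N. \<Sum>r\<le>comps c. wt (AddBot c r))"
    using finite_codes by (simp add: sum.Sigma)
  also have "\<dots> = (\<Sum>c\<in>codes N. fps_const (4/27) * bot_op (wt c))"
  proof (rule sum.cong)
    fix c
    have "(\<Sum>r\<le>comps c. wt (AddBot c r)) = fps_const ((4/27) ^ Suc (points c)) * (\<Sum>r\<le>comps c. (1 + fps_X) ^ Suc r)"
      by (simp add: wt_def sum_distrib_left)
    also have "\<dots> = fps_const (4/27) * (fps_const ((4/27) ^ points c) * bot_op ((1 + fps_X) ^ comps c))"
      unfolding sum_comps_bot_op by (simp flip: mult.assoc)
    finally show "(\<Sum>r\<le>comps c. wt (AddBot c r)) = fps_const (4/27) * bot_op (wt c)"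
      by (simp only: wt_def bot_op_const_mult)
  qed simp
  finally show ?thesis by (simp only: bot_op_sum sum_distrib_left)
qed

lemma sum_wt_top_codes_Suc:
  "le_fps (\<Sum>c\<in>top_codes (Suc N). wt c)
     (fps_const (4/27) * (\<Sum>c\<in>codes N. wt c) + fps_const (4/27) * (\<Sum>c\<in>codes N. wt c) * (\<Sum>c\<in>top_codes N. wt c))"
proof -
  let ?A = "AddTop ` codes N" and ?B = "case_prod AddTopAbove ` (codes N \<times> top_codes N)"
  have fin: "finite ?A" "finite ?B"
    using finite_codes finite_top_codes by auto
  have split: "le_fps (\<Sum>c\<in>top_codes (Suc N). wt c) (\<Sum>c\<in>?A \<union> ?B. wt c)"
    using fin top_codes_Suc nonneg_wt by (intro sum_fps_mono_set) auto
  have "le_fps (\<Sum>c\<in>?A \<union> ?B. wt c) ((\<Sum>c\<in>?A. wt c) + (\<Sum>c\<in>?B. wt c))"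
    using fin nonneg_wt by (intro sum_fps_Un_le)
  moreover have "(\<Sum>c\<in>?A. wt c) = fps_const (4/27) * (\<Sum>c\<in>codes N. wt c)"
    by (subst sum.reindex) (auto simp: inj_on_def wt_def sum_distrib_left simp flip: mult.assoc)
  moreover have "(\<Sum>c\<in>?B. wt c) = fps_const (4/27) * (\<Sum>c\<in>codes N. wt c) * (\<Sum>c\<in>top_codes N. wt c)"
  proof -
    have "(\<Sum>c\<in>?B. wt c) = (\<Sum>(c, d)\<in>codes N \<times> top_codes N. wt (AddTopAbove c d))"
      by (subst sum.reindex) (auto simp: inj_on_def case_prod_unfold)
    also have "\<dots> = (\<Sum>(c, d)\<in>codes N \<times> top_codes N. (fps_const (4/27) * wt c) * wt d)"
    proof (intro sum.cong, simp)
      fix p :: "dcode \<times> dcode"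
      obtain c d where p: "p = (c, d)" by (cases p)
      have "wt (AddTopAbove c d) = fps_const (4/27) * wt c * wt d"
        by (simp only: wt_def points.simps comps.simps power_add power_Suc mult_ac flip: fps_const_mult)
      then show "(case p of (c, d) \<Rightarrow> wt (AddTopAbove c d)) = (case p of (c, d) \<Rightarrow> fps_const (4/27) * wt c * wt d)"
        by (simp add: p)
    qed
    also have "\<dots> = (\<Sum>c\<in>codes N. fps_const (4/27) * wt c) * (\<Sum>c\<in>top_codes N. wt c)"
      by (simp add: sum_product sum.cartesian_product)
    finally show ?thesis by (simp only: sum_distrib_left)
  qed
  ultimately show ?thesis
    using le_fps_trans[OF split] by (simp only:)
qed

lemma sum_wt_codes_Suc:
  "le_fps (\<Sum>c\<in>codes (Suc N). wt c)
     (1 + fps_const (4/27) * bot_op (\<Sum>c\<in>codes N. wt c) + (\<Sum>c\<in>top_codes (Suc N). wt c))"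
proof -
  let ?A = "case_prod AddBot ` (SIGMA c:codes N. {..comps c})"
  have fin: "finite ?A"
    using finite_codes by auto
  have split: "le_fps (\<Sum>c\<in>codes (Suc N). wt c) (\<Sum>c\<in>insert Empty ?A \<union> top_codes (Suc N). wt c)"
    using fin finite_top_codes codes_Suc nonneg_wt by (intro sum_fps_mono_set) auto
  have "le_fps (\<Sum>c\<in>insert Empty ?A \<union> top_codes (Suc N). wt c)
      ((\<Sum>c\<in>insert Empty ?A. wt c) + (\<Sum>c\<in>top_codes (Suc N). wt c))"
    using fin finite_top_codes nonneg_wt by (intro sum_fps_Un_le) auto
  moreover have "(\<Sum>c\<in>insert Empty ?A. wt c) = 1 + fps_const (4/27) * bot_op (\<Sum>c\<in>codes N. wt c)"
  proof -
    have "Empty \<notin> ?A" by auto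
    then show ?thesis using fin by (simp add: sum_wt_AddBot) (simp add: wt_def)
  qed
  ultimately show ?thesis
    using le_fps_trans[OF split] by (simp only:)
qed

text \<open>
  The functional equation itself, obtained from \<open>kernel_eq\<close> by cancelling \<open>4 v\<close>.
\<close>

lemma crit_fix: "fps_const (27/4) * crit_G = 1 + fps_const (4/27) * bot_op (fps_const (27/4) * crit_G) + crit_T"
proof -
  have c1: "4 * fps_const (27/4 :: real) = 27"
    by (simp only: numeral_fps_const fps_const_mult) simp
  have c2: "4 * fps_const (1/4 :: real) = 1"
    by (simp only: numeral_fps_const fps_const_mult) simp
  have b: "fps_const (4/27) * bot_op (fps_const (27/4) * crit_G) = bot_op crit_G"
    by (simp only: bot_op_const_mult mult.assoc[symmetric] fps_const_mult) simp
  have "(4 * fps_X) * (fps_const (27/4) * crit_G) = fps_X * ((4 * fps_const (27/4)) * crit_G)"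
    by (simp only: mult_ac)
  also have "\<dots> = fps_X * (27 * crit_G)"
    by (simp only: c1)
  also have "\<dots> = 4 * fps_X * (1 + bot_op crit_G + crit_T)"
  proof -
    have "4 * (fps_X * bot_op crit_G) = 4 * (1 + fps_X)\<^sup>2 * crit_G - (1 + fps_X) * (4 * fps_const (1/4))"
      unfolding X_mult_bot_op crit_G_0 by (simp only: right_diff_distrib mult_ac)
    then have "4 * (fps_X * bot_op crit_G) = 4 * (1 + fps_X)\<^sup>2 * crit_G - (1 + fps_X)"
      by (simp only: c2 mult_1_right)
    then show ?thesis using kernel_eq by algebra
  qed
  finally have "fps_const (27/4) * crit_G = 1 + bot_op crit_G + crit_T"
    by (subst (asm) mult_left_cancel) auto
  then show ?thesis unfolding b .
qed

text \<open>
  The truncations of the generating function arise by iterating a monotone operator from below, so they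
  stay below its nonnegative fixed point.
\<close>

lemma sum_wt_le:
  "le_fps (\<Sum>c\<in>codes N. wt c) (fps_const (27/4) * crit_G) \<and> le_fps (\<Sum>c\<in>top_codes N. wt c) crit_T"
proof (induction N)
  case 0
  have "1 \<le> 27 / 4 * crit_G $ 0" by (simp add: crit_G_0)
  then have "le_fps 1 (fps_const (27/4) * crit_G)"
    using nonneg_crit_G by (auto simp: le_fps_def nonneg_fps_def crit_G_0)
  then show ?case using nonneg_crit_T by (simp add: codes_0 wt_def) (simp add: le_fps_def nonneg_fps_def)
next
  case (Suc N)
  let ?W = "\<Sum>c\<in>codes N. wt c" and ?V = "\<Sum>c\<in>top_codes N. wt c"
  have W: "le_fps (fps_const (4/27) * ?W) crit_G"
    using Suc by (simp add: le_fps_def field_simps)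
  have nn: "nonneg_fps (fps_const (4/27) * ?W)"
    by (intro nonneg_fps_mult nonneg_fps_sum nonneg_wt nonneg_fps_const) simp
  have "le_fps (fps_const (4/27) * ?W + fps_const (4/27) * ?W * ?V) (crit_G + crit_G * crit_T)"
    using Suc by (intro le_fps_add le_fps_mult W nn nonneg_crit_T) auto
  then have V: "le_fps (\<Sum>c\<in>top_codes (Suc N). wt c) crit_T"
    unfolding crit_T_fix[symmetric] by (rule le_fps_trans[OF sum_wt_top_codes_Suc])
  have "le_fps (bot_op ?W) (bot_op (fps_const (27/4) * crit_G))"
    using Suc by (intro le_fps_bot_op) auto
  then have "le_fps (fps_const (4/27) * bot_op ?W) (fps_const (4/27) * bot_op (fps_const (27/4) * crit_G))"
    by (simp add: le_fps_def)
  then have "le_fps (1 + fps_const (4/27) * bot_op ?W + (\<Sum>c\<in>top_codes (Suc N). wt c))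
      (1 + fps_const (4/27) * bot_op (fps_const (27/4) * crit_G) + crit_T)"
    by (intro le_fps_add V le_fps_refl)
  then have "le_fps (\<Sum>c\<in>codes (Suc N). wt c) (fps_const (27/4) * crit_G)"
    unfolding crit_fix[symmetric] by (rule le_fps_trans[OF sum_wt_codes_Suc])
  then show ?case using V by blast
qed

lemma sum_points_codes_le: "(\<Sum>c\<in>codes N. (4/27) ^ points c) \<le> (27/16 :: real)"
proof -
  have "wt c $ 0 = (4/27) ^ points c" for c
    by (simp add: wt_def fps_nth_power_0)
  then have "(\<Sum>c\<in>codes N. (4/27) ^ points c) = (\<Sum>c\<in>codes N. wt c) $ 0"
    by (simp add: fps_sum_nth)
  also have "\<dots> \<le> 27/16"
    using sum_wt_le[of N] by (auto simp: le_fps_def crit_G_0 dest!: spec[of _ 0])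
  finally show ?thesis .
qed

text \<open>
  Splitting off the first code \<open>c\<close> and using the bound for \<open>n - points c\<close> leaves the factor
  \<open>\<Sum> (4/27) ^ points c\<close> over the nonempty codes, which is at most \<open>27/16 - 1\<close> and so at most 1.
\<close>

lemma code_seqs_bound: "finite (code_seqs n) \<and> real (card (code_seqs n)) \<le> (27/4) ^ n"
proof (induction n rule: less_induct)
  case (less n)
  have points_pos: "points c > 0" if "c \<noteq> Empty" for c
    using that by (cases c) auto
  show ?case
  proof (cases "n = 0")
    case True
    have "code_seqs 0 = {[]}"
    proof -
      have "cs = []" if "cs \<in> code_seqs 0" for cs
        using that points_pos[of "hd cs"] by (cases cs) (auto simp: code_seqs_def)
      then show ?thesis by (auto simp: code_seqs_def)
    qed
    then show ?thesis using True by simp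
  next
    case False
    let ?C = "codes n - {Empty}"
    let ?S = "SIGMA c:?C. code_seqs (n - points c)"
    have sub: "code_seqs n \<subseteq> case_prod (#) ` ?S"
    proof
      fix cs assume cs: "cs \<in> code_seqs n"
      then obtain c ds where "cs = c # ds"
        using False by (cases cs) (auto simp: code_seqs_def)
      then show "cs \<in> case_prod (#) ` ?S"
        using cs by (auto simp: code_seqs_def codes_def intro!: image_eqI[of _ _ "(c, ds)"])
    qed
    have lt: "n - points c < n" if "c \<in> ?C" for c
      using that points_pos[of c] False by auto
    have fin: "finite ?S"
      using finite_codes less lt by (intro finite_SigmaI) auto
    have "card (code_seqs n) \<le> card ?S"
      using card_mono[OF finite_imageI[OF fin] sub] card_image_le[OF fin] by (rule order_trans)
    also have "card ?S = (\<Sum>c\<in>?C. card (code_seqs (n - points c)))"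
      using finite_codes less lt by (intro card_SigmaI) auto
    finally have "real (card (code_seqs n)) \<le> (\<Sum>c\<in>?C. real (card (code_seqs (n - points c))))"
      by (metis of_nat_le_iff of_nat_sum)
    also have "\<dots> \<le> (\<Sum>c\<in>?C. (27/4) ^ n * (4/27) ^ points c)"
    proof (rule sum_mono)
      fix c assume c: "c \<in> ?C"
      have "(27/4 :: real) ^ n = (27/4) ^ (n - points c) * (27/4) ^ points c"
        using c by (simp add: codes_def flip: power_add)
      then have "(27/4 :: real) ^ n * (4/27) ^ points c = (27/4) ^ (n - points c) * ((27/4) * (4/27)) ^ points c"
        by (simp only: power_mult_distrib mult_ac)
      then show "real (card (code_seqs (n - points c))) \<le> (27/4) ^ n * (4/27) ^ points c"
        using less lt[OF c] by simp
    qed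
    also have "\<dots> = (27/4) ^ n * ((\<Sum>c\<in>codes n. (4/27) ^ points c) - 1)"
      using finite_codes by (simp add: sum_distrib_left right_diff_distrib sum_diff1 codes_def)
    also have "\<dots> \<le> (27/4) ^ n * 1"
      using sum_points_codes_le[of n] by (intro mult_left_mono) auto
    finally show ?thesis
      using finite_subset[OF sub] fin by simp
  qed
qed

section \<open>Counting the avoiders\<close>

lemma order_isomorphic_1324:
  "order_isomorphic xs [1, 3, 2, 4] \<longleftrightarrow> (\<exists>a b c d. xs = [a, b, c, d] \<and> a < c \<and> c < b \<and> b < d)"
proof
  assume iso: "order_isomorphic xs [1, 3, 2, 4]"
  then have "length xs = 4" by (simp add: order_isomorphic_def)
  then obtain a b c d where xs: "xs = [a, b, c, d]"
    by (auto simp: numeral_eq_Suc length_Suc_conv)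
  have less: "xs ! i < xs ! j \<longleftrightarrow> [1, 3, 2, 4::nat] ! i < [1, 3, 2, 4] ! j" if "i < 4" "j < 4" for i j
    using iso that \<open>length xs = 4\<close> unfolding order_isomorphic_def by simp
  have "a < c" "c < b" "b < d"
    using less[of 0 2] less[of 2 1] less[of 1 3] by (simp_all add: xs)
  then show "\<exists>a b c d. xs = [a, b, c, d] \<and> a < c \<and> c < b \<and> b < d"
    using xs by blast
next
  assume "\<exists>a b c d. xs = [a, b, c, d] \<and> a < c \<and> c < b \<and> b < d"
  then show "order_isomorphic xs [1, 3, 2, 4]"
    by (auto simp: order_isomorphic_def numeral_eq_Suc less_Suc_eq)
qed

definition avoiders :: "nat \<Rightarrow> nat list set" where
  "avoiders n = {p. set p = {1..n} \<and> distinct p \<and> av1324 p}"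

lemma Av_len_1324: "Av_len n [1, 3, 2, 4] = avoiders n"
  unfolding Av_len_def contains_pattern_def order_isomorphic_1324 avoiders_def av1324_def
    permutations_of_set_def by blast

lemma finite_avoiders: "finite (avoiders n)"
  using finite_Av_len[of n "[1, 3, 2, 4]"] unfolding Av_len_1324 .

lemma length_avoiders: "p \<in> avoiders n \<Longrightarrow> length p = n"
  using distinct_card[of p] by (simp add: avoiders_def)

lemma card_avoiders_le: "real (card (avoiders n)) \<le> (27/2) ^ n"
proof -
  let ?A = "avoiders n"
  have perm: "set p = {1..n}" "distinct p" "length p = n" "av1324 p" if "p \<in> ?A" for p
    using that length_avoiders by (auto simp: avoiders_def)
  have "\<forall>p\<in>?A. \<exists>q. staircase p (fst q) (snd q)"
  proof
    fix p assume "p \<in> ?A"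
    then obtain U cs where "staircase p U cs"
      using ex_staircase perm(2,4) by blast
    then show "\<exists>q. staircase p (fst q) (snd q)"
      by (intro exI[of _ "(U, cs)"]) simp
  qed
  from bchoice[OF this] obtain f where f: "staircase p (fst (f p)) (snd (f p))" if "p \<in> ?A" for p
    by blast
  have "inj_on f ?A"
  proof (rule inj_onI)
    fix p q assume p: "p \<in> ?A" and q: "q \<in> ?A" and "f p = f q"
    then have "staircase q (fst (f p)) (snd (f p))" using f[OF q] by simp
    then show "p = q"
      by (rule staircase_unique[OF f[OF p]]) (simp_all add: perm[OF p] perm[OF q])
  qed
  moreover have "f ` ?A \<subseteq> Pow {1..n} \<times> code_seqs n"
  proof
    fix q assume "q \<in> f ` ?A"
    then obtain p where p: "p \<in> ?A" "q = f p" by blast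
    then show "q \<in> Pow {1..n} \<times> code_seqs n"
      using staircase_props[OF f[OF p(1)]] perm[OF p(1)] by (simp add: mem_Times_iff)
  qed
  moreover have "finite (Pow {1..n} \<times> code_seqs n)"
    using code_seqs_bound by simp
  ultimately have "card ?A \<le> card (Pow {1..n} \<times> code_seqs n)"
    by (rule card_inj_on_le)
  also have "\<dots> = 2 ^ n * card (code_seqs n)"
    by (simp add: card_cartesian_product card_Pow)
  finally have "real (card ?A) \<le> real (2 ^ n * card (code_seqs n))"
    by (simp only: of_nat_le_iff)
  also have "\<dots> \<le> 2 ^ n * (27/4) ^ n"
    using code_seqs_bound by simp
  also have "\<dots> = (27/2) ^ n"
    by (simp flip: power_mult_distrib)
  finally show ?thesis .
qed

text \<open>
  A copy of 1324 that meets both parts would have its first entry in the upper part and its last entry in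
  the lower part, although the last entry is the largest.
\<close>

lemma av1324_skew_sum:
  assumes "av1324 p" "av1324 q" "\<forall>x\<in>set p. \<forall>z\<in>set q. z < x"
  shows "av1324 (p @ q)"
  unfolding av1324_def
proof (intro notI, elim exE conjE)
  fix a b c d
  assume sub: "subseq [a, b, c, d] (p @ q)" and less: "a < c" "c < b" "b < d"
  then obtain us vs where uv: "[a, b, c, d] = us @ vs" "subseq us p" "subseq vs q"
    by (elim subseq_appendE)
  show False
  proof (cases "us = [] \<or> vs = []")
    case True
    then have "subseq [a, b, c, d] p \<or> subseq [a, b, c, d] q"
      using uv by auto
    then show False
      using less assms(1,2) unfolding av1324_def by blast
  next
    case False
    have "hd [a, b, c, d] = hd us" "last [a, b, c, d] = last vs"
      unfolding uv(1) using False by simp_all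
    then have "a \<in> set us" "d \<in> set vs"
      using False by simp_all
    then have "a \<in> set p" "d \<in> set q"
      using subseq_set uv by blast+
    then have "d < a" using assms(3) by blast
    then show False using less by simp
  qed
qed

lemma av1324_shift: "av1324 p \<Longrightarrow> av1324 (map (\<lambda>x. x + n) p)"
  unfolding av1324_def
proof (intro notI, elim exE conjE notE)
  fix a b c d
  assume sub: "subseq [a, b, c, d] (map (\<lambda>x. x + n) p)" and less: "a < c" "c < b" "b < d"
  have "subseq (map (\<lambda>x. x - n) [a, b, c, d]) (map (\<lambda>x. x - n) (map (\<lambda>x. x + n) p))"
    using sub by (rule subseq_map)
  then have "subseq [a - n, b - n, c - n, d - n] p"
    by (simp add: comp_def)
  moreover have "n \<le> a"
    using subseq_set[OF sub] by auto
  then have "a - n < c - n" "c - n < b - n" "b - n < d - n"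
    using less by linarith+
  ultimately show "\<exists>a b c d. subseq [a, b, c, d] p \<and> a < c \<and> c < b \<and> b < d"
    by blast
qed

lemma card_avoiders_supermult:
  "card (avoiders m) * card (avoiders n) \<le> card (avoiders (m + n))"
proof -
  let ?f = "\<lambda>(p, q). map (\<lambda>x. x + n) p @ q"
  have "inj_on ?f (avoiders m \<times> avoiders n)"
  proof (rule inj_onI, clarify)
    fix p q p' q'
    assume *: "p \<in> avoiders m" "p' \<in> avoiders m"
      "map (\<lambda>x. x + n) p @ q = map (\<lambda>x. x + n) p' @ q'"
    then have "map (\<lambda>x. x + n) p = map (\<lambda>x. x + n) p'" "q = q'"
      using length_avoiders by (simp_all add: append_eq_append_conv)
    moreover have "inj (\<lambda>x. x + n)" by simp
    ultimately show "p = p' \<and> q = q'"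
      by (metis inj_map_eq_map)
  qed
  moreover have "?f ` (avoiders m \<times> avoiders n) \<subseteq> avoiders (m + n)"
  proof (clarify)
    fix p q
    assume p: "p \<in> avoiders m" and q: "q \<in> avoiders n"
    have set: "set p = {1..m}" "set q = {1..n}" "distinct p" "distinct q"
      using p q by (auto simp: avoiders_def)
    have shift: "(\<lambda>x. x + n) ` {1..m} = {1 + n..m + n}"
      by (rule image_add_atLeastAtMost')
    have "av1324 (map (\<lambda>x. x + n) p @ q)"
      using p q set by (intro av1324_skew_sum av1324_shift) (auto simp: avoiders_def)
    moreover have "set (map (\<lambda>x. x + n) p @ q) = {1..m + n}"
      using set shift by auto
    moreover have "distinct (map (\<lambda>x. x + n) p @ q)"
      using set by (auto simp: distinct_map)
    ultimately show "map (\<lambda>x. x + n) p @ q \<in> avoiders (m + n)"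
      by (simp add: avoiders_def)
  qed
  ultimately have "card (avoiders m \<times> avoiders n) \<le> card (avoiders (m + n))"
    using finite_avoiders by (rule card_inj_on_le)
  then show ?thesis by (simp add: card_cartesian_product)
qed

lemma card_avoiders_pos: "card (avoiders n) \<ge> 1"
proof -
  have "av1324 (rev [1..<Suc n])"
  proof (induction n)
    case 0
    then show ?case by (simp add: av1324_def)
  next
    case (Suc n)
    have "av1324 [Suc n]"
      unfolding av1324_def by (auto dest: list_emb_length)
    then have "av1324 ([Suc n] @ rev [1..<Suc n])"
      by (rule av1324_skew_sum[OF _ Suc]) (auto simp del: upt_Suc)
    then show ?case by simp
  qed
  then have "rev [1..<Suc n] \<in> avoiders n"
    unfolding avoiders_def by (auto simp del: upt_Suc)
  then show ?thesis
    using finite_avoiders by (metis One_nat_def Suc_leI card_gt_0_iff empty_iff)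
qed

section \<open>The growth rate\<close>

text \<open>
  Fekete's lemma: the quotients converge to their supremum \<open>L\<close>. Superadditivity applied to \<open>n div m\<close> copies of
  \<open>m\<close> shows that \<open>b n / n\<close> is at least \<open>b m / m - b m / n\<close>.
\<close>

lemma superadditive_quotient_convergent:
  fixes b :: "nat \<Rightarrow> real"
  assumes super: "\<And>m n. b m + b n \<le> b (m + n)" and nonneg: "\<And>n. 0 \<le> b n" and bound: "\<And>n. b n \<le> real n * K"
  shows "convergent (\<lambda>n. b n / real n)"
proof -
  define L where "L = (SUP n. b n / real n)"
  have bdd: "bdd_above (range (\<lambda>n. b n / real n))"
  proof (rule bdd_aboveI2)
    fix n
    show "b n / real n \<le> \<bar>K\<bar>"
    proof (cases "n = 0")
      case False
      have "b n \<le> real n * \<bar>K\<bar>"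
        by (rule order_trans[OF bound mult_left_mono]) simp_all
      then show ?thesis using False by (simp add: field_simps)
    qed simp
  qed
  have mult: "real k * b m \<le> b (k * m)" for k m
  proof (induction k)
    case (Suc k)
    then show ?case using super[of m "k * m"] by (simp add: algebra_simps)
  qed (use nonneg in simp)
  have "(\<lambda>n. b n / real n) \<longlonglongrightarrow> L"
  proof (rule order_tendstoI)
    fix x assume "L < x"
    then show "\<forall>\<^sub>F n in sequentially. b n / real n < x"
      using cSUP_upper[OF _ bdd] unfolding L_def by (intro always_eventually) (auto intro: le_less_trans)
  next
    fix x assume "x < L"
    then obtain m where m: "x < b m / real m"
      unfolding L_def using less_cSUP_iff[OF _ bdd] by auto
    \<comment> \<open>Since \<open>b 0 / real 0 = 0\<close>, the supremum may also be attained at the index 0.\<close>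
    show "\<forall>\<^sub>F n in sequentially. x < b n / real n"
    proof (cases "m = 0")
      case True
      then have "x < 0" using m by simp
      then show ?thesis
        using nonneg by (intro always_eventually) (auto intro: less_le_trans)
    next
      case False
      have "(\<lambda>n. b m / real m - b m / real n) \<longlonglongrightarrow> b m / real m - 0"
        by (intro tendsto_intros lim_const_over_n)
      then have "\<forall>\<^sub>F n in sequentially. x < b m / real m - b m / real n"
        using m by (intro order_tendstoD) auto
      then show ?thesis
        using eventually_gt_at_top[of 0]
      proof eventually_elim
        case (elim n)
        have "real n / real m - 1 \<le> real (n div m)"
          by (smt (verit) False floor_divide_of_nat_eq of_int_of_nat_eq real_of_int_floor_gt_diff_one)
        then have "(real n / real m - 1) * b m \<le> real (n div m) * b m"
          using nonneg by (rule mult_right_mono)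
        also have "\<dots> \<le> b (n div m * m)" by (rule mult)
        also have "\<dots> \<le> b (n div m * m) + b (n mod m)" using nonneg by simp
        also have "\<dots> \<le> b n" using super[of "n div m * m" "n mod m"] by simp
        finally have "(real n / real m - 1) * b m / real n \<le> b n / real n"
          by (rule divide_right_mono) simp
        moreover have "(real n / real m - 1) * b m / real n = b m / real m - b m / real n"
          using elim(2) False by (simp add: field_simps)
        ultimately have "b m / real m - b m / real n \<le> b n / real n"
          by simp
        then show ?case using elim(1) by simp
      qed
    qed
  qed
  then show ?thesis by (rule convergentI)
qed

theorem theorem4p1:
  shows "growth_rate (Av [1, 3, 2, 4]) \<le> 27 / 2"
proof -
  define a where "a n = real (card (avoiders n))" for n
  have a_ge: "1 \<le> a n" for n
    using card_avoiders_pos[of n] unfolding a_def by linarith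
  have "convergent (\<lambda>n. ln (a n) / real n)"
  proof (rule superadditive_quotient_convergent)
    show "ln (a m) + ln (a n) \<le> ln (a (m + n))" for m n
    proof -
      have "a m * a n \<le> a (m + n)"
        using card_avoiders_supermult unfolding a_def by (metis of_nat_le_iff of_nat_mult)
      then have "ln (a m * a n) \<le> ln (a (m + n))"
        using a_ge[of m] a_ge[of n] by (intro ln_mono mult_pos_pos) auto
      then show ?thesis
        using a_ge[of m] a_ge[of n] by (simp add: ln_mult)
    qed
    show "0 \<le> ln (a n)" for n
      using a_ge by (simp add: ln_ge_zero)
    show "ln (a n) \<le> real n * ln (27/2)" for n
    proof -
      have "ln (a n) \<le> ln ((27/2) ^ n)"
        using card_avoiders_le[of n] a_ge[of n] unfolding a_def by (intro ln_mono) auto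
      then show ?thesis by (simp add: ln_realpow)
    qed
  qed
  then obtain l where "(\<lambda>n. ln (a n) / real n) \<longlonglongrightarrow> l"
    unfolding convergent_def by blast
  then have "(\<lambda>n. exp (ln (a n) / real n)) \<longlonglongrightarrow> exp l"
    by (rule tendsto_exp)
  moreover have "\<forall>\<^sub>F n in sequentially. exp (ln (a n) / real n) = root n (a n)"
    using eventually_gt_at_top[of 0]
  proof eventually_elim
    case (elim n)
    then show ?case
      using a_ge[of n] by (simp add: root_powr_inverse powr_def)
  qed
  ultimately have lim: "(\<lambda>n. root n (a n)) \<longlonglongrightarrow> exp l"
    using tendsto_cong by force
  have "exp l \<le> 27 / 2"
  proof (rule tendsto_upperbound[OF lim])
    show "\<forall>\<^sub>F n in sequentially. root n (a n) \<le> 27 / 2"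
      using eventually_gt_at_top[of 0]
    proof eventually_elim
      case (elim n)
      have "root n (a n) \<le> root n ((27/2) ^ n)"
        using elim card_avoiders_le[of n] unfolding a_def by simp
      then show ?case using elim by (simp add: real_root_power_cancel)
    qed
  qed simp
  moreover have "growth_rate (Av [1, 3, 2, 4]) = exp l"
    using lim unfolding growth_rate_def Av_length_slice Av_len_1324 a_def by (rule limI)
  ultimately show ?thesis by simp
qed

end
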